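(* Let $t\ge 1$ and $k\ge 0$ be integers. If $t>1$, then $C_{2,2}(t+tk,k)=(t+tk-2)\,\varphi(t)$, where $\varphi$ is Euler's totient function. If $t=1$, then $C_{2,2}(1+k,k)=k$ (i.e. $t+tk-1$), for $k\ge 1$.
   Context: Let $V$ be an $n$-dimensional vector space over $\mathbb{C}$ with basis $e_1,\dots,e_n$. For compositions $\mathbf{a}=(a_1,\dots,a_m)$ and $\mathbf{b}=(b_1,\dots,b_t)$ of $n$ (sequences of positive integers summing to $n$), the seaweed algebra $\frac{a_1|\cdots|a_m}{b_1|\cdots|b_t}$ is the subalgebra of $\mathfrak{sl}(n)$ of traceless matrices preserving both flags $V_1\subset\cdots\subset V_m=V$, $V_i=\mathrm{span}\{e_1,\dots,e_{a_1+\cdots+a_i}\}$, and $V=W_0\supset\cdots\supset W_t=\{0\}$, $W_j=\mathrm{span}\{e_{b_1+\cdots+b_j+1},\dots,e_n\}$. The index of a finite-dimensional Lie algebra $\mathfrak{g}$ is $\min_{f\in\mathfrak{g}^*}\dim\ker B_f$, where $B_f(x,y)=f([x,y])$. $C_{2,2}(n,k)$ denotes the number of quadruples $(a,b,c,d)$ of positive integers with $a+b=c+d=n$ such that the seaweed $\frac{a|b}{c|d}$ has index $k$. *)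

theory Defs
  imports Main "HOL-Library.Function_Algebras" "HOL-Number_Theory.Totient"
begin

text \<open>Vectors of V = C^n are functions nat => complex vanishing at indices >= n
  (basis vector e_p corresponds to index p-1). Matrices are functions
  nat => nat => complex vanishing outside {0..<n} x {0..<n}.\<close>

definition vecs :: "nat \<Rightarrow> (nat \<Rightarrow> complex) set" where
  "vecs n = {v. \<forall>p. n \<le> p \<longrightarrow> v p = 0}"

definition mats :: "nat \<Rightarrow> (nat \<Rightarrow> nat \<Rightarrow> complex) set" where
  "mats n = {M. \<forall>i j. (n \<le> i \<or> n \<le> j) \<longrightarrow> M i j = 0}"

definition mat_vec :: "nat \<Rightarrow> (nat \<Rightarrow> nat \<Rightarrow> complex) \<Rightarrow> (nat \<Rightarrow> complex) \<Rightarrow> (nat \<Rightarrow> complex)" where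
  "mat_vec n M v = (\<lambda>i. \<Sum>j<n. M i j * v j)"

definition mat_mul :: "nat \<Rightarrow> (nat \<Rightarrow> nat \<Rightarrow> complex) \<Rightarrow> (nat \<Rightarrow> nat \<Rightarrow> complex) \<Rightarrow> (nat \<Rightarrow> nat \<Rightarrow> complex)" where
  "mat_mul n A B = (\<lambda>i j. \<Sum>l<n. A i l * B l j)"

definition bracket :: "nat \<Rightarrow> (nat \<Rightarrow> nat \<Rightarrow> complex) \<Rightarrow> (nat \<Rightarrow> nat \<Rightarrow> complex) \<Rightarrow> (nat \<Rightarrow> nat \<Rightarrow> complex)" where
  "bracket n A B = (\<lambda>i j. mat_mul n A B i j - mat_mul n B A i j)"

definition trace :: "nat \<Rightarrow> (nat \<Rightarrow> nat \<Rightarrow> complex) \<Rightarrow> complex" where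
  "trace n M = (\<Sum>i<n. M i i)"

definition is_composition :: "nat list \<Rightarrow> nat \<Rightarrow> bool" where
  "is_composition as n \<longleftrightarrow> (\<forall>x\<in>set as. 0 < x) \<and> sum_list as = n"

text \<open>Flag subspaces: V_i = span{e_1,...,e_{a_1+...+a_i}}, W_j = span{e_{b_1+...+b_j+1},...,e_n}.\<close>
definition flagV :: "nat \<Rightarrow> nat list \<Rightarrow> nat \<Rightarrow> (nat \<Rightarrow> complex) set" where
  "flagV n as i = {v \<in> vecs n. \<forall>p. sum_list (take i as) \<le> p \<longrightarrow> v p = 0}"

definition flagW :: "nat \<Rightarrow> nat list \<Rightarrow> nat \<Rightarrow> (nat \<Rightarrow> complex) set" where
  "flagW n bs j = {v \<in> vecs n. \<forall>p. p < sum_list (take j bs) \<longrightarrow> v p = 0}"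

definition preserves :: "nat \<Rightarrow> (nat \<Rightarrow> nat \<Rightarrow> complex) \<Rightarrow> (nat \<Rightarrow> complex) set \<Rightarrow> bool" where
  "preserves n M U \<longleftrightarrow> (\<forall>v\<in>U. mat_vec n M v \<in> U)"

definition seaweed :: "nat \<Rightarrow> nat list \<Rightarrow> nat list \<Rightarrow> (nat \<Rightarrow> nat \<Rightarrow> complex) set" where
  "seaweed n as bs = {M \<in> mats n. trace n M = 0 \<and>
      (\<forall>i\<in>{1..length as}. preserves n M (flagV n as i)) \<and>
      (\<forall>j\<in>{0..length bs}. preserves n M (flagW n bs j))}"

abbreviation cscale :: "complex \<Rightarrow> (nat \<Rightarrow> nat \<Rightarrow> complex) \<Rightarrow> (nat \<Rightarrow> nat \<Rightarrow> complex)" where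
  "cscale c M \<equiv> (\<lambda>i j. c * M i j)"

definition cdim :: "(nat \<Rightarrow> nat \<Rightarrow> complex) set \<Rightarrow> nat" where
  "cdim S = vector_space.dim cscale S"

definition linear_on :: "(nat \<Rightarrow> nat \<Rightarrow> complex) set \<Rightarrow> ((nat \<Rightarrow> nat \<Rightarrow> complex) \<Rightarrow> complex) \<Rightarrow> bool" where
  "linear_on g f \<longleftrightarrow> (\<forall>x\<in>g. \<forall>y\<in>g. f (x + y) = f x + f y) \<and> (\<forall>c. \<forall>x\<in>g. f (cscale c x) = c * f x)"

definition kerB :: "nat \<Rightarrow> (nat \<Rightarrow> nat \<Rightarrow> complex) set \<Rightarrow> ((nat \<Rightarrow> nat \<Rightarrow> complex) \<Rightarrow> complex) \<Rightarrow> (nat \<Rightarrow> nat \<Rightarrow> complex) set" where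
  "kerB n g f = {x \<in> g. \<forall>y\<in>g. f (bracket n x y) = 0}"

definition lie_index :: "nat \<Rightarrow> (nat \<Rightarrow> nat \<Rightarrow> complex) set \<Rightarrow> nat" where
  "lie_index n g = (LEAST d. \<exists>f. linear_on g f \<and> d = cdim (kerB n g f))"

definition C22 :: "nat \<Rightarrow> nat \<Rightarrow> nat" where
  "C22 n k = card {(a, b, c, d). 0 < a \<and> 0 < b \<and> 0 < c \<and> 0 < d \<and> a + b = n \<and> c + d = n \<and>
                  lie_index n (seaweed n [a, b] [c, d]) = k}"

end

theory Submission
  imports Defs "Jordan_Normal_Form.Determinant"
begin

text \<open>The index of the seaweed \<open>a|b\<close> over \<open>c|d\<close> is \<open>g - 1\<close> with \<open>g = gcd n (a - c)\<close>; the formula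
  for \<open>C\<^sub>2\<^sub>,\<^sub>2\<close> then counts pairs \<open>(a, c)\<close> by the residue of \<open>a - c\<close>. We work in \<open>gl\<close>, where the index
  goes up by one.

  A Euclidean recursion from \<open>n\<close> to \<open>|a - c|\<close> produces a functional \<open>F\<close> whose kernel lies in the
  torus \<open>T\<close> of \<open>g\<close>-periodic diagonal matrices, so the index is at most \<open>g\<close>. Moreover \<open>F\<close> commutes
  with \<open>T\<close>, so the annihilator of \<open>T\<close> consists of the functionals \<open>[F, u]\<close>; hence every functional is,
  to first order, a conjugate of \<open>F\<close> plus a diagonal matrix, whose kernel contains a conjugate of
  \<open>T\<close>. Comparing lowest-order terms of a determinant, no functional can have a kernel of dimension
  less than \<open>g\<close>.\<close>

text \<open>The upper bound needs one functional, the lower bound concerns all of them. The natural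
  argument for the latter is that the conjugates of \<open>F + W\<close>, with \<open>W\<close>
  diagonal, fill a neighbourhood of \<open>F\<close>: their kernels all have dimension at least
  \<open>g\<close>, so the large minors of the coadjoint map vanish on an open set, hence
  everywhere. That would take an inverse function theorem for the conjugation map. Only its
  derivative is used here: every direction is tangent to a curve of such conjugates, and the lowest
  homogeneous part of a minor at \<open>F\<close> is the limit of its rescaled values along these
  curves, so it cannot be nonzero.

  The sizes in the Euclidean step come from following a kernel element along its diagonals in steps
  of \<open>m = |a - c|\<close>. An entry whose diagonal leaves the matrix sideways must vanish, and
  the remainders \<open>c mod m\<close> and \<open>(n - a) mod m\<close> record where the borders
  cut the central window; these cuts are the blocks of the smaller seaweed.\<close>

section \<open>A functional with toral kernel\<close>

text \<open>Matrix positions \<open>(i, j)\<close>, counted from \<open>0\<close>, that may be nonzero in the seaweed with blocks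
  \<open>a|n-a\<close> over \<open>c|n-c\<close>. Blocks of size \<open>0\<close> are allowed: the recursion below produces them.\<close>
definition admissible :: "nat \<Rightarrow> nat \<Rightarrow> nat \<Rightarrow> nat \<Rightarrow> bool" where
  "admissible a c i j \<longleftrightarrow> (j < a \<longrightarrow> i < a) \<and> (i < c \<longrightarrow> j < c)"

definition gl_seaweed :: "nat \<Rightarrow> nat \<Rightarrow> nat \<Rightarrow> (nat \<Rightarrow> nat \<Rightarrow> complex) set" where
  "gl_seaweed n a c = {x \<in> mats n. \<forall>i j. x i j \<noteq> 0 \<longrightarrow> admissible a c i j}"

text \<open>The kernel of \<open>B\<^sub>f\<close> for the functional \<open>f x = trace (F x)\<close>: as \<open>f [x, y] = trace ([F, x] y)\<close>, only the
  entries of \<open>[F, x]\<close> at transposed admissible positions matter.\<close>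
definition gl_kernel ::
  "nat \<Rightarrow> nat \<Rightarrow> nat \<Rightarrow> (nat \<Rightarrow> nat \<Rightarrow> complex) \<Rightarrow> (nat \<Rightarrow> nat \<Rightarrow> complex) set" where
  "gl_kernel n a c F = {x \<in> gl_seaweed n a c.
     \<forall>i<n. \<forall>j<n. admissible a c j i \<longrightarrow> bracket n F x i j = 0}"

definition periodic_diag :: "nat \<Rightarrow> nat \<Rightarrow> (nat \<Rightarrow> nat \<Rightarrow> complex) set" where
  "periodic_diag n g = {x \<in> mats n. (\<forall>i j. i \<noteq> j \<longrightarrow> x i j = 0) \<and>
     (\<forall>i<n. \<forall>j<n. i mod g = j mod g \<longrightarrow> x i i = x j j)}"

text \<open>The difference is formed in \<open>int\<close>, because truncated subtraction would be
  wrong for \<open>a < c\<close>.\<close>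

definition seaweed_gcd :: "nat \<Rightarrow> nat \<Rightarrow> nat \<Rightarrow> nat" where
  "seaweed_gcd n a c = nat (gcd (int n) (int a - int c))"

text \<open>The condition on residues makes \<open>F\<close> commute with the whole torus. It is
  carried along with the kernel condition because the recursion uses both: the second makes a window
  \<open>B\<close> periodic diagonal, the first then gives \<open>[G, B] = 0\<close>.\<close>

definition regular_form :: "nat \<Rightarrow> nat \<Rightarrow> nat \<Rightarrow> (nat \<Rightarrow> nat \<Rightarrow> complex) \<Rightarrow> bool" where
  "regular_form n a c F \<longleftrightarrow>
     (\<forall>i j. F i j \<noteq> 0 \<longrightarrow> i < n \<and> j < n \<and> admissible a c j i \<and>
        i mod seaweed_gcd n a c = j mod seaweed_gcd n a c) \<and>
     gl_kernel n a c F \<subseteq> periodic_diag n (seaweed_gcd n a c)"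

section \<open>Diagonal brackets, the symmetric case and transposition\<close>

lemma admissible_refl [simp]: "admissible a c i i"
  by (simp add: admissible_def)

lemma admissible_trans: "admissible a c i l \<Longrightarrow> admissible a c l j \<Longrightarrow> admissible a c i j"
  by (auto simp: admissible_def)

lemma seaweed_gcd_commute: "seaweed_gcd n a c = seaweed_gcd n c a"
  by (metis gcd_neg2_int minus_diff_eq seaweed_gcd_def)

lemma bracket_diagonal_left:
  fixes D x :: "nat \<Rightarrow> nat \<Rightarrow> complex"
  assumes "\<And>i j. i \<noteq> j \<Longrightarrow> D i j = 0" "i < n" "j < n"
  shows "bracket n D x i j = (D i i - D j j) * x i j"
proof -
  have "mat_mul n D x i j = (\<Sum>l<n. if l = i then D i i * x i j else 0)"
    unfolding mat_mul_def using assms(1) by (intro sum.cong) auto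
  moreover have "mat_mul n x D i j = (\<Sum>l<n. if l = j then x i j * D j j else 0)"
    unfolding mat_mul_def using assms(1) by (intro sum.cong) auto
  ultimately show ?thesis
    using assms(2,3) by (simp add: bracket_def algebra_simps)
qed

lemma bracket_diagonal_right:
  fixes D x :: "nat \<Rightarrow> nat \<Rightarrow> complex"
  assumes "\<And>i j. i \<noteq> j \<Longrightarrow> D i j = 0" "i < n" "j < n"
  shows "bracket n x D i j = x i j * (D j j - D i i)"
proof -
  have "bracket n D x i j = (D i i - D j j) * x i j"
    by (rule bracket_diagonal_left) (use assms in auto)
  then show ?thesis by (simp add: bracket_def algebra_simps)
qed

text \<open>With distinct diagonal entries in \<open>F\<close>, the equation
  \<open>(F i i - F j j) * x i j = 0\<close> kills every off-diagonal entry, provided it is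
  available at each position where \<open>x\<close> may be nonzero; this is what symmetry ensures.
  For \<open>g = n\<close> periodicity is automatic.\<close>

lemma regular_form_symmetric:
  assumes sym: "\<And>i j. i < n \<Longrightarrow> j < n \<Longrightarrow> admissible a c i j \<Longrightarrow> admissible a c j i"
    and g: "seaweed_gcd n a c = n"
  shows "\<exists>F. regular_form n a c F"
proof -
  define F :: "nat \<Rightarrow> nat \<Rightarrow> complex" where "F i j = (if i = j \<and> i < n then of_nat i else 0)" for i j
  have "x \<in> periodic_diag n n" if x: "x \<in> gl_kernel n a c F" for x
  proof -
    have xm: "x \<in> mats n" and adm: "\<And>i j. x i j \<noteq> 0 \<Longrightarrow> admissible a c i j"
      and br: "\<And>i j. i < n \<Longrightarrow> j < n \<Longrightarrow> admissible a c j i \<Longrightarrow> bracket n F x i j = 0"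
      using x by (auto simp: gl_kernel_def gl_seaweed_def)
    have "x i j = 0" if "i \<noteq> j" for i j
    proof (rule ccontr)
      assume nz: "x i j \<noteq> 0"
      then have ij: "i < n" "j < n" using xm by (auto simp: mats_def not_le[symmetric])
      then have "bracket n F x i j = 0" using br sym adm nz by blast
      moreover have "bracket n F x i j = (F i i - F j j) * x i j"
        by (rule bracket_diagonal_left) (use ij in \<open>auto simp: F_def\<close>)
      ultimately show False using nz ij that by (auto simp: F_def)
    qed
    then show ?thesis using xm by (auto simp: periodic_diag_def)
  qed
  then have "regular_form n a c F"
    unfolding regular_form_def g by (auto simp: F_def split: if_splits)
  then show ?thesis by blast
qed

text \<open>Transposition exchanges the two flags and reverses commutators. It reduces the recursion
  to the case \<open>c < a\<close>.\<close>

lemma regular_form_transpose: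
  assumes F: "regular_form n a c F"
  shows "regular_form n c a (\<lambda>i j. F j i)"
proof -
  have adm: "admissible c a i j \<longleftrightarrow> admissible a c j i" for i j
    by (auto simp: admissible_def)
  have br: "bracket n (\<lambda>i j. F j i) x i j = - bracket n F (\<lambda>i j. x j i) j i" for x i j
    unfolding bracket_def mat_mul_def by (simp add: mult.commute[of "F _ _"])
  have "x \<in> periodic_diag n (seaweed_gcd n a c)" if x: "x \<in> gl_kernel n c a (\<lambda>i j. F j i)" for x
  proof -
    have "bracket n F (\<lambda>i j. x j i) i j = 0" if "i < n" "j < n" "admissible a c j i" for i j
    proof -
      have "bracket n (\<lambda>i j. F j i) x j i = 0" using x that by (simp add: gl_kernel_def adm)
      then show ?thesis by (simp only: br neg_equal_0_iff_equal)
    qed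
    moreover have "(\<lambda>i j. x j i) \<in> gl_seaweed n a c"
      using x unfolding gl_kernel_def gl_seaweed_def mats_def by (auto simp: adm)
    ultimately have "(\<lambda>i j. x j i) \<in> gl_kernel n a c F"
      by (simp add: gl_kernel_def)
    then have "(\<lambda>i j. x j i) \<in> periodic_diag n (seaweed_gcd n a c)"
      using F by (auto simp: regular_form_def)
    then have *: "\<And>i j. (n \<le> i \<or> n \<le> j) \<Longrightarrow> x j i = 0" "\<And>i j. i \<noteq> j \<Longrightarrow> x j i = 0"
      "\<And>i j. i < n \<Longrightarrow> j < n \<Longrightarrow> i mod seaweed_gcd n a c = j mod seaweed_gcd n a c \<Longrightarrow> x i i = x j j"
      unfolding periodic_diag_def mats_def by blast+
    show ?thesis unfolding periodic_diag_def mats_def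
      by (intro CollectI conjI allI impI; rule *) auto
  qed
  moreover have "\<forall>i j. F j i \<noteq> 0 \<longrightarrow> i < n \<and> j < n \<and> admissible c a j i \<and>
        i mod seaweed_gcd n a c = j mod seaweed_gcd n a c"
    using F unfolding regular_form_def adm by metis
  ultimately show ?thesis unfolding regular_form_def seaweed_gcd_commute[of n c a] by blast
qed

text \<open>Modulo \<open>m = a - c\<close> the new difference is
  \<open>- c - (n - a) = m - n\<close>, hence congruent to \<open>- n\<close>. This is a step of
  Euclid's algorithm on \<open>n\<close> and \<open>a - c\<close>.\<close>

lemma seaweed_gcd_reduce:
  assumes "c < a" "a \<le> n"
  shows "seaweed_gcd (a - c) (a - c - c mod (a - c)) ((n - a) mod (a - c)) = seaweed_gcd n a c"
proof -
  define m where "m = a - c"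
  have m: "m > 0" "int a - int c = int m" using assms by (auto simp: m_def)
  have "int (m - c mod m) = int m - int c mod int m"
    using m by (simp add: of_nat_diff zmod_int less_imp_le)
  moreover have "int ((n - a) mod m) = (int n - int a) mod int m"
    using assms by (simp add: of_nat_diff zmod_int)
  moreover have "gcd (int m) (int m - int c mod int m - (int n - int a) mod int m) = gcd (int m) (int n)"
  proof -
    have "(int m - int c mod int m - (int n - int a) mod int m) mod int m
        = (int m - int c - (int n - int a)) mod int m"
      by (metis mod_diff_cong mod_diff_right_eq)
    also have "int m - int c - (int n - int a) = - int n + 2 * int m" using m by simp
    also have "\<dots> mod int m = (- int n) mod int m" by (rule mod_mult_self1)
    finally have eq: "(int m - int c mod int m - (int n - int a) mod int m) mod int m
        = (- int n) mod int m" .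
    then have "gcd (int m) (int m - int c mod int m - (int n - int a) mod int m) = gcd (int m) (- int n)"
      using gcd_red_int[of _ "int m"] gcd.commute by metis
    then show ?thesis by simp
  qed
  ultimately show ?thesis
    unfolding seaweed_gcd_def m_def[symmetric] using m by (simp add: gcd.commute)
qed

text \<open>With \<open>m = a - c\<close>, put \<open>G\<close> in the diagonal window \<open>[c, a)\<close> and add unit entries that shift indices
  by \<open>m\<close> away from the window. The commutator equations then make \<open>x\<close> constant along diagonals
  in steps of \<open>m\<close>, which determines \<open>x\<close> by its window \<open>B\<close> and forces \<open>B\<close> into the kernel of \<open>G\<close> for a
  smaller seaweed.\<close>
locale shift_extension =
  fixes n a c :: nat and G :: "nat \<Rightarrow> nat \<Rightarrow> complex"
  assumes ca: "c < a" and an: "a \<le> n"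
    and G: "regular_form (a - c) (a - c - c mod (a - c)) ((n - a) mod (a - c)) G"
begin

definition "m = a - c"
definition "\<rho> = c mod m"
definition "\<sigma> = (n - a) mod m"

definition F :: "nat \<Rightarrow> nat \<Rightarrow> complex" where
  "F i j = (if j = i + m \<and> j < a \<or> i = j + m \<and> c \<le> j \<and> i < n then 1
     else if c \<le> i \<and> i < a \<and> c \<le> j \<and> j < a then G (i - c) (j - c) else 0)"

lemma m: "0 < m" "a = c + m"
  using ca by (auto simp: m_def)

lemma \<rho>: "\<rho> < m" "c = c div m * m + \<rho>"
  using m div_mult_mod_eq[of c m] by (auto simp: \<rho>_def)

lemma \<sigma>: "\<sigma> < m" "n = a + (n - a) div m * m + \<sigma>"
  using m(1) an div_mult_mod_eq[of "n - a" m] unfolding \<sigma>_def by (simp, linarith)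

lemma gcd_reduce: "seaweed_gcd m (m - \<rho>) \<sigma> = seaweed_gcd n a c"
  using seaweed_gcd_reduce[OF ca an] by (simp add: m_def \<rho>_def \<sigma>_def)

lemma gcd_dvd_m: "seaweed_gcd n a c dvd m"
proof -
  have "int (seaweed_gcd n a c) dvd int a - int c" by (simp add: seaweed_gcd_def)
  moreover have "int a - int c = int m" using m by simp
  ultimately show ?thesis by (simp only: int_dvd_int_iff)
qed

lemma mod_gcd_add [simp]:
  "(i + m) mod seaweed_gcd n a c = i mod seaweed_gcd n a c"
  using gcd_dvd_m by (metis dvd_def mod_mult_self2)

lemma mod_gcd_shift:
  "(i + c) mod seaweed_gcd n a c = (j + c) mod seaweed_gcd n a c \<longleftrightarrow>
   i mod seaweed_gcd n a c = j mod seaweed_gcd n a c"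
  using cong_add_rcancel_nat unfolding cong_def by blast

lemma G_support:
  assumes "G i j \<noteq> 0"
  shows "i < m" "j < m" "admissible (m - \<rho>) \<sigma> j i"
    "i mod seaweed_gcd n a c = j mod seaweed_gcd n a c"
  using assms G unfolding regular_form_def m_def[symmetric] \<rho>_def[symmetric] \<sigma>_def[symmetric] gcd_reduce
  by blast+

lemma F_support:
  assumes "F i j \<noteq> 0"
  shows "i < n \<and> j < n \<and> admissible a c j i \<and> i mod seaweed_gcd n a c = j mod seaweed_gcd n a c"
proof -
  consider "j = i + m" "j < a" | "i = j + m" "c \<le> j" "i < n"
    | "c \<le> i" "i < a" "c \<le> j" "j < a" "G (i - c) (j - c) \<noteq> 0"
    using assms by (auto simp: F_def split: if_splits)
  then show ?thesis
  proof cases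
    case 3
    then have "(i - c + c) mod seaweed_gcd n a c = (j - c + c) mod seaweed_gcd n a c"
      using G_support(4) mod_gcd_shift by blast
    then show ?thesis using 3 an by (auto simp: admissible_def)
  qed (use m an in \<open>auto simp: admissible_def\<close>)
qed

lemma F_row_top: "i < c \<Longrightarrow> F i l = (if l = i + m then 1 else 0)"
  using m by (auto simp: F_def)

lemma F_row_bottom: "a \<le> i \<Longrightarrow> i < n \<Longrightarrow> F i l = (if l = i - m then 1 else 0)"
  using m by (auto simp: F_def)

lemma F_row_middle:
  "c \<le> i \<Longrightarrow> i < a \<Longrightarrow> F i l = (if c \<le> l \<and> l < a then G (i - c) (l - c) else 0)"
  using m by (auto simp: F_def)

end

lemma sum_window:
  fixes f :: "nat \<Rightarrow> complex"
  assumes "c + m \<le> n"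
  shows "(\<Sum>l<n. if c \<le> l \<and> l < c + m then f l else 0) = (\<Sum>l<m. f (c + l))"
proof -
  have "(\<Sum>l<n. if c \<le> l \<and> l < c + m then f l else 0) = (\<Sum>l\<in>{c..<c + m}. f l)"
    using assms by (intro sum.mono_neutral_cong_right) auto
  also have "\<dots> = (\<Sum>l<m. f (c + l))"
    by (rule sum.reindex_bij_witness[of _ "\<lambda>l. c + l" "\<lambda>l. l - c"]) auto
  finally show ?thesis .
qed

section \<open>Kernel elements of the extended functional\<close>

locale shift_kernel = shift_extension +
  fixes x :: "nat \<Rightarrow> nat \<Rightarrow> complex"
  assumes x: "x \<in> gl_kernel n a c F"
begin

definition B :: "nat \<Rightarrow> nat \<Rightarrow> complex" where
  "B i j = (if i < m \<and> j < m then x (c + i) (c + j) else 0)"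

lemma x_outside: "n \<le> i \<or> n \<le> j \<Longrightarrow> x i j = 0"
  using x by (auto simp: gl_kernel_def gl_seaweed_def mats_def)

lemma x_admissible: "x i j \<noteq> 0 \<Longrightarrow> admissible a c i j"
  using x by (auto simp: gl_kernel_def gl_seaweed_def)

lemma x_zero_top: "i < c \<Longrightarrow> c \<le> j \<Longrightarrow> x i j = 0"
  using x_admissible[of i j] by (auto simp: admissible_def)

lemma x_zero_bottom: "a \<le> i \<Longrightarrow> j < a \<Longrightarrow> x i j = 0"
  using x_admissible[of i j] by (auto simp: admissible_def)

lemma x_bracket: "i < n \<Longrightarrow> j < n \<Longrightarrow> admissible a c j i \<Longrightarrow> bracket n F x i j = 0"
  using x by (auto simp: gl_kernel_def)

text \<open>Row \<open>i < c\<close> of \<open>F\<close> has its only entry in column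
  \<open>i + m\<close>, and row \<open>i\<close> of \<open>x\<close> vanishes from column
  \<open>c\<close> on, so both products shrink to one term. The value \<open>0\<close> arises when
  column \<open>j - m\<close> would lie left of the matrix.\<close>

lemma top_relation:
  assumes "i < c" "j < a"
  shows "x (i + m) j = (if m \<le> j then x i (j - m) else 0)"
proof -
  have "mat_mul n F x i j = (\<Sum>l<n. if l = i + m then x (i + m) j else 0)"
    unfolding mat_mul_def using F_row_top[OF assms(1)] by (intro sum.cong) auto
  moreover have "mat_mul n x F i j = (\<Sum>l<n. if l = j - m then (if m \<le> j then x i (j - m) else 0) else 0)"
    unfolding mat_mul_def
  proof (intro sum.cong refl)
    fix l
    show "x i l * F l j = (if l = j - m then (if m \<le> j then x i (j - m) else 0) else 0)"
    proof (cases "l < c")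
      case True
      then show ?thesis using F_row_top[of l j] by auto
    next
      case False
      then show ?thesis using x_zero_top[OF assms(1), of l] assms(2) m by auto
    qed
  qed
  moreover have "bracket n F x i j = 0"
    using assms an m by (intro x_bracket) (auto simp: admissible_def)
  ultimately show ?thesis
    using assms an m by (auto simp: bracket_def split: if_splits)
qed

lemma bottom_relation:
  assumes "a \<le> i" "i < n" "c \<le> j" "j < n"
  shows "x (i - m) j = (if j + m < n then x i (j + m) else 0)"
proof -
  have "mat_mul n F x i j = (\<Sum>l<n. if l = i - m then x (i - m) j else 0)"
    unfolding mat_mul_def using F_row_bottom[OF assms(1,2)] by (intro sum.cong) auto
  moreover have "mat_mul n x F i j = (\<Sum>l<n. if l = j + m then x i (j + m) else 0)"
    unfolding mat_mul_def
  proof (intro sum.cong refl)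
    fix l assume "l \<in> {..<n}"
    then show "x i l * F l j = (if l = j + m then x i (j + m) else 0)"
      using F_row_bottom[of l j] x_zero_bottom[OF assms(1), of l] assms m
      by (cases "a \<le> l") auto
  qed
  moreover have "bracket n F x i j = 0"
    using assms m by (intro x_bracket) (auto simp: admissible_def)
  ultimately show ?thesis
    using assms m by (auto simp: bracket_def split: if_splits)
qed

text \<open>Rows of \<open>F\<close> through the window contain only \<open>G\<close>, but its
  columns there also contain the unit entries above and below. These contribute the two terms
  outside the commutator.\<close>

lemma middle_relation:
  assumes "i < m" "j < m"
  shows "bracket m G B i j =
    (if m \<le> c + j then x (c + i) (c + j - m) else 0)
    + (if c + j + m < n then x (c + i) (c + j + m) else 0)"
proof -
  have "mat_mul n F x (c + i) (c + j) =
      (\<Sum>l<n. if c \<le> l \<and> l < c + m then G i (l - c) * x l (c + j) else 0)"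
    unfolding mat_mul_def using F_row_middle[of "c + i"] assms m by (intro sum.cong) auto
  also have "\<dots> = mat_mul m G B i j"
    using an m assms by (subst sum_window) (auto simp: mat_mul_def B_def)
  finally have FB: "mat_mul n F x (c + i) (c + j) = mat_mul m G B i j" .
  have "mat_mul n x F (c + i) (c + j) =
     (\<Sum>l<n. (if l = c + j - m then (if m \<le> c + j then x (c + i) (c + j - m) else 0) else 0)
      + (if l = c + j + m then x (c + i) (c + j + m) else 0)
      + (if c \<le> l \<and> l < c + m then x (c + i) l * G (l - c) j else 0))"
    unfolding mat_mul_def
  proof (intro sum.cong refl)
    fix l assume l: "l \<in> {..<n}"
    consider "l < c" | "c \<le> l" "l < a" | "a \<le> l" by linarith
    then show "x (c + i) l * F l (c + j) =
      (if l = c + j - m then (if m \<le> c + j then x (c + i) (c + j - m) else 0) else 0)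
      + (if l = c + j + m then x (c + i) (c + j + m) else 0)
      + (if c \<le> l \<and> l < c + m then x (c + i) l * G (l - c) j else 0)"
    proof cases
      case 1
      then show ?thesis using F_row_top[of l "c + j"] assms m by auto
    next
      case 2
      then show ?thesis using F_row_middle[of l "c + j"] assms m by auto
    next
      case 3
      then show ?thesis using F_row_bottom[of l "c + j"] assms m l by auto
    qed
  qed
  also have "\<dots> = (if m \<le> c + j then x (c + i) (c + j - m) else 0)
      + (if c + j + m < n then x (c + i) (c + j + m) else 0)
      + (\<Sum>l<n. if c \<le> l \<and> l < c + m then x (c + i) l * G (l - c) j else 0)"
    using assms m an by (auto simp: sum.distrib)
  also have "(\<Sum>l<n. if c \<le> l \<and> l < c + m then x (c + i) l * G (l - c) j else 0) = mat_mul m B G i j"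
    using an m assms by (subst sum_window) (auto simp: mat_mul_def B_def)
  finally have xB: "mat_mul n x F (c + i) (c + j) =
      (if m \<le> c + j then x (c + i) (c + j - m) else 0)
      + (if c + j + m < n then x (c + i) (c + j + m) else 0) + mat_mul m B G i j" .
  have "bracket n F x (c + i) (c + j) = 0"
    using assms m an by (intro x_bracket) (auto simp: admissible_def)
  then show ?thesis using FB xB by (simp add: bracket_def algebra_simps)
qed

lemma top_shift:
  "i + s * m < a \<Longrightarrow> j < a \<Longrightarrow> x (i + s * m) j = (if s * m \<le> j then x i (j - s * m) else 0)"
proof (induction s arbitrary: j)
  case (Suc s)
  have "x (i + s * m + m) j = (if m \<le> j then x (i + s * m) (j - m) else 0)"
    using Suc.prems m by (intro top_relation) auto
  also have "\<dots> = (if Suc s * m \<le> j then x i (j - Suc s * m) else 0)"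
    using Suc.prems by (auto simp: Suc.IH)
  finally show ?case by (simp add: algebra_simps)
qed simp

lemma bottom_shift:
  "c \<le> i \<Longrightarrow> i + s * m < n \<Longrightarrow> c \<le> j \<Longrightarrow> j < n \<Longrightarrow>
    x i j = (if j + s * m < n then x (i + s * m) (j + s * m) else 0)"
proof (induction s arbitrary: i j)
  case (Suc s)
  have "x i j = (if j + m < n then x (i + m) (j + m) else 0)"
    using Suc.prems m bottom_relation[of "i + m" j] by auto
  also have "\<dots> = (if j + Suc s * m < n then x (i + Suc s * m) (j + Suc s * m) else 0)"
    using Suc.prems Suc.IH[of "i + m" "j + m"] by (auto simp: algebra_simps)
  finally show ?case .
qed (auto simp: x_outside)

text \<open>Going back \<open>s\<close> steps along the diagonal crosses the left border while the
  row is still inside the matrix.\<close>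

lemma top_shift_zero:
  assumes "s * m \<le> i" "i < a" "j < s * m" "j < a"
  shows "x i j = 0"
  using top_shift[of "i - s * m" s j] assms by auto

lemma bottom_shift_zero:
  assumes "c \<le> i" "i + s * m < n" "c \<le> j" "n \<le> j + s * m"
  shows "x i j = 0"
  using bottom_shift[of i s j] assms x_outside[of i j] by (cases "j < n") auto

text \<open>The right-hand side of \<open>middle_relation\<close> is supported off the dual positions of
  the smaller seaweed: its two terms live in opposite corners, and so can be separated.\<close>
lemma left_term_zero:
  assumes "i < m" "j < m" "m \<le> c + j" "\<not> (i < m - \<rho> \<and> m - \<rho> \<le> j)"
  shows "x (c + i) (c + j - m) = 0"
\<comment> \<open>Row \<open>c + i\<close> admits \<open>Suc (c div m)\<close> steps back if
  \<open>i \<ge> m - \<rho>\<close>, and only \<open>c div m\<close> steps otherwise. This is how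
  the remainder becomes a block size.\<close>
proof (cases "m - \<rho> \<le> i")
  case True
  then show ?thesis
    using assms \<rho> m top_shift_zero[of "Suc (c div m)" "c + i" "c + j - m"] by (auto; linarith?)
next
  case False
  then show ?thesis
    using assms \<rho> m top_shift_zero[of "c div m" "c + i" "c + j - m"] by (auto; linarith?)
qed

lemma right_term_zero:
  assumes "i < m" "j < m" "\<not> (\<sigma> \<le> i \<and> j < \<sigma>)"
  shows "x (c + i) (c + j + m) = 0"
proof (cases "i < \<sigma>")
  case True
  then show ?thesis
    using assms \<sigma> m bottom_shift_zero[of "c + i" "Suc ((n - a) div m)" "c + j + m"] by (auto; linarith?)
next
  case False
  then show ?thesis
    using assms \<sigma> m bottom_shift_zero[of "c + i" "(n - a) div m" "c + j + m"] by (auto; linarith?)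
qed

text \<open>A window entry at a forbidden position would be shifted out of the matrix, so
  \<open>B\<close> lies in the smaller seaweed. At the dual positions of that seaweed both outer
  terms of \<open>middle_relation\<close> vanish, which leaves the commutator equation for
  \<open>G\<close>.\<close>

lemma B_kernel: "B \<in> gl_kernel m (m - \<rho>) \<sigma> G"
proof -
  have "admissible (m - \<rho>) \<sigma> i j" if "B i j \<noteq> 0" for i j
  proof (rule ccontr)
    have ij: "i < m" "j < m" "x (c + i) (c + j) \<noteq> 0" using that by (auto simp: B_def split: if_splits)
    assume "\<not> admissible (m - \<rho>) \<sigma> i j"
    then consider "j < m - \<rho>" "m - \<rho> \<le> i" | "i < \<sigma>" "\<sigma> \<le> j" by (auto simp: admissible_def)
    then show False
    proof cases
      case 1
      then show ?thesis using ij \<rho> m top_shift_zero[of "Suc (c div m)" "c + i" "c + j"] by (auto; linarith?)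
    next
      case 2
      then show ?thesis
        using ij \<sigma> m bottom_shift_zero[of "c + i" "Suc ((n - a) div m)" "c + j"] by (auto; linarith?)
    qed
  qed
  moreover have "bracket m G B i j = 0"
    if "i < m" "j < m" "admissible (m - \<rho>) \<sigma> j i" for i j
    using that middle_relation[of i j] left_term_zero[of i j] right_term_zero[of i j]
    by (auto simp: admissible_def)
  moreover have "B \<in> mats m" by (auto simp: mats_def B_def)
  ultimately show ?thesis by (auto simp: gl_kernel_def gl_seaweed_def)
qed

lemma B_diag: "B \<in> periodic_diag m (seaweed_gcd n a c)"
  using B_kernel G gcd_reduce
  unfolding regular_form_def m_def[symmetric] \<rho>_def[symmetric] \<sigma>_def[symmetric] by auto

lemma B_off_diag: "i \<noteq> j \<Longrightarrow> B i j = 0"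
  using B_diag unfolding periodic_diag_def by blast

lemma B_periodic:
  "i < m \<Longrightarrow> j < m \<Longrightarrow> i mod seaweed_gcd n a c = j mod seaweed_gcd n a c \<Longrightarrow> B i i = B j j"
  using B_diag unfolding periodic_diag_def by blast

text \<open>\<open>B\<close> is now diagonal and constant on residue classes, while \<open>G\<close>
  links only equal residues. So the commutator in \<open>middle_relation\<close> vanishes at all
  positions of the window.\<close>

lemma middle_sum_zero:
  assumes "i < m" "j < m"
  shows "(if m \<le> c + j then x (c + i) (c + j - m) else 0)
    + (if c + j + m < n then x (c + i) (c + j + m) else 0) = 0"
proof -
  have "bracket m G B i j = G i j * (B j j - B i i)"
    using B_off_diag assms by (rule bracket_diagonal_right)
  moreover have "G i j * (B j j - B i i) = 0"
    using B_periodic[OF assms] G_support(4)[of i j] by (cases "G i j = 0") auto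
  ultimately show ?thesis using middle_relation[OF assms] by simp
qed

text \<open>Columns below \<open>c div m * m\<close> are settled by shifting alone. For the others,
  the left term can be nonzero only if \<open>i < m - \<rho> \<le> j\<close> and the right one only
  if \<open>j < \<sigma> \<le> i\<close>. These conditions exclude each other, so the vanishing sum
  kills both terms.\<close>

lemma left_zero:
  assumes "c \<le> i" "i < a" "l < c"
  shows "x i l = 0"
proof (cases "l < c div m * m")
  case True
  then show ?thesis using assms \<rho> top_shift_zero[of "c div m" i l] by linarith
next
  case False
  define i' j' where "i' = i - c" and "j' = l + m - c"
  have 1: "i' < m" "j' < m" "c + i' = i" "c + j' - m = l" "m \<le> c + j'"
    using assms False m \<rho> unfolding i'_def j'_def by linarith+
  show ?thesis
  proof (cases "i' < m - \<rho> \<and> m - \<rho> \<le> j'")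
    case True
    then have "x (c + i') (c + j' + m) = 0" using right_term_zero[OF 1(1,2)] by auto
    then show ?thesis using middle_sum_zero[OF 1(1,2)] 1 by (auto split: if_splits)
  next
    case False
    then show ?thesis using left_term_zero[OF 1(1,2,5)] 1 by auto
  qed
qed

lemma right_zero:
  assumes "c \<le> i" "i < a" "a \<le> l"
  shows "x i l = 0"
proof (cases "l + (n - a) div m * m < n")
  case False
  then show ?thesis using assms \<sigma> bottom_shift_zero[of i "(n - a) div m" l] m by linarith
next
  case True
  define i' j' where "i' = i - c" and "j' = l - m - c"
  have 1: "i' < m" "j' < m" "c + i' = i" "c + j' + m = l" "l < n"
    using assms True m \<sigma> unfolding i'_def j'_def by linarith+
  show ?thesis
  proof (cases "\<sigma> \<le> i' \<and> j' < \<sigma>")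
    case True
    then have "m \<le> c + j' \<Longrightarrow> x (c + i') (c + j' - m) = 0" using left_term_zero[OF 1(1,2)] by auto
    then show ?thesis using middle_sum_zero[OF 1(1,2)] 1 by (auto split: if_splits)
  next
    case False
    then show ?thesis using right_term_zero[OF 1(1,2)] 1 by auto
  qed
qed

lemma middle_diag:
  assumes "c \<le> i" "i < a" "c \<le> j" "j < a" "i \<noteq> j"
  shows "x i j = 0"
proof -
  have "B (i - c) (j - c) = 0" using assms by (intro B_off_diag) auto
  moreover have "i - c < m" "j - c < m" using assms m by linarith+
  ultimately show ?thesis using assms by (simp add: B_def)
qed

lemma middle_periodic:
  assumes "c \<le> i" "i < a" "c \<le> j" "j < a" "i mod seaweed_gcd n a c = j mod seaweed_gcd n a c"
  shows "x i i = x j j"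
proof -
  have "(i - c) mod seaweed_gcd n a c = (j - c) mod seaweed_gcd n a c"
    using assms mod_gcd_shift[of "i - c" "j - c"] by simp
  moreover have less: "i - c < m" "j - c < m" using assms m by linarith+
  ultimately have "B (i - c) (i - c) = B (j - c) (j - c)"
    using B_periodic by blast
  then show ?thesis using assms less by (simp add: B_def)
qed

text \<open>Rows above the window are reached by induction towards it: up to column \<open>c\<close>
  such a row is a copy of the row \<open>m\<close> further down, moved along the diagonal, and from
  column \<open>c\<close> on it is zero. Steps of \<open>m\<close> preserve residues modulo the
  gcd.\<close>

lemma top_propagate:
  "i < a \<Longrightarrow> j < a \<Longrightarrow> (i \<noteq> j \<longrightarrow> x i j = 0) \<and>
    (\<exists>k. c \<le> k \<and> k < a \<and> k mod seaweed_gcd n a c = i mod seaweed_gcd n a c \<and> x i i = x k k)"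
proof (induction "a - i" arbitrary: i j rule: less_induct)
  case less
  show ?case
  proof (cases "c \<le> i")
    case True
    then show ?thesis using less.prems left_zero[of i j] middle_diag[of i j] by (cases "j < c") auto
  next
    case False
    then have i: "i + m < a" using m by simp
    have shift: "x i k = x (i + m) (k + m)" if "k < c" for k
      using top_relation[of i "k + m"] that False m by auto
    have IH: "k < a \<Longrightarrow> (i + m \<noteq> k \<longrightarrow> x (i + m) k = 0) \<and>
      (\<exists>k. c \<le> k \<and> k < a \<and> k mod seaweed_gcd n a c = (i + m) mod seaweed_gcd n a c
         \<and> x (i + m) (i + m) = x k k)" for k
      using i m less.hyps[of "i + m" k] by auto
    have "x i j = 0" if "i \<noteq> j"
      using that shift[of j] IH[of "j + m"] m x_zero_top[of i j] False by (cases "j < c") auto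
    moreover have "x i i = x (i + m) (i + m)" using shift False by auto
    ultimately show ?thesis using IH[OF i] by auto
  qed
qed

lemma bottom_propagate:
  "c \<le> i \<Longrightarrow> i < n \<Longrightarrow> c \<le> j \<Longrightarrow> j < n \<Longrightarrow> (i \<noteq> j \<longrightarrow> x i j = 0) \<and>
    (\<exists>k. c \<le> k \<and> k < a \<and> k mod seaweed_gcd n a c = i mod seaweed_gcd n a c \<and> x i i = x k k)"
proof (induction i arbitrary: j rule: less_induct)
  case (less i)
  show ?case
  proof (cases "i < a")
    case True
    then show ?thesis using less.prems right_zero[of i j] middle_diag[of i j] by (cases "a \<le> j") auto
  next
    case False
    have shift: "x i k = x (i - m) (k - m)" if "a \<le> k" "k < n" for k
      using bottom_relation[of i "k - m"] that False less.prems m by auto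
    have IH: "c \<le> k \<Longrightarrow> k < n \<Longrightarrow> (i - m \<noteq> k \<longrightarrow> x (i - m) k = 0) \<and>
      (\<exists>k. c \<le> k \<and> k < a \<and> k mod seaweed_gcd n a c = (i - m) mod seaweed_gcd n a c
         \<and> x (i - m) (i - m) = x k k)" for k
      using m less.IH[of "i - m" k] less.prems False by auto
    have md: "(i - m) mod seaweed_gcd n a c = i mod seaweed_gcd n a c"
      using mod_gcd_add[of "i - m"] False m by simp
    have "x i j = 0" if "i \<noteq> j"
      using that shift[of j] IH[of "j - m"] m x_zero_bottom[of i j] False less.prems
      by (cases "a \<le> j") auto
    moreover have "x i i = x (i - m) (i - m)" using shift False less.prems by auto
    ultimately show ?thesis using IH[of c] m an ca md by auto
  qed
qed

lemma x_periodic_diag: "x \<in> periodic_diag n (seaweed_gcd n a c)"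
proof -
  have "x i j = 0" if "i \<noteq> j" for i j
  proof -
    consider "n \<le> i \<or> n \<le> j" | "i < a" "j < a" | "c \<le> i" "i < n" "c \<le> j" "j < n"
      | "i < c" "c \<le> j" | "a \<le> i" "j < a"
      using ca by linarith
    then show ?thesis
      using that x_outside x_zero_top x_zero_bottom top_propagate bottom_propagate by cases blast+
  qed
  moreover have "\<exists>k. c \<le> k \<and> k < a \<and> k mod seaweed_gcd n a c = i mod seaweed_gcd n a c \<and> x i i = x k k"
    if "i < n" for i
    using that top_propagate[of i i] bottom_propagate[of i i] ca by (cases "i < a") auto
  then have "x i i = x j j"
    if "i < n" "j < n" "i mod seaweed_gcd n a c = j mod seaweed_gcd n a c" for i j
    using that middle_periodic by metis
  moreover have "x \<in> mats n" using x_outside by (auto simp: mats_def)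
  ultimately show ?thesis unfolding periodic_diag_def by blast
qed

end

lemma (in shift_extension) regular_form_F: "regular_form n a c F"
proof -
  have "x \<in> periodic_diag n (seaweed_gcd n a c)" if "x \<in> gl_kernel n a c F" for x
  proof -
    interpret shift_kernel n a c G x by unfold_locales (rule that)
    show ?thesis by (rule x_periodic_diag)
  qed
  then show ?thesis unfolding regular_form_def using F_support by blast
qed

text \<open>The window size \<open>|a - c|\<close> is smaller than \<open>n\<close> unless the
  seaweed is all of \<open>gl\<close>. That case and \<open>a = c\<close>, where the seaweed is a
  product of two full matrix algebras, have symmetric positions and end the recursion.\<close>

theorem regular_form_exists:
  "a \<le> n \<Longrightarrow> c \<le> n \<Longrightarrow> \<exists>F. regular_form n a c F"
proof (induction n arbitrary: a c rule: less_induct)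
  case (less n)
  have step: "\<exists>F. regular_form n a c F" if ac: "c < a" "a \<le> n" for a c
  proof (cases "a = n \<and> c = 0")
    case True
    then show ?thesis
      by (intro regular_form_symmetric) (auto simp: admissible_def seaweed_gcd_def)
  next
    case False
    define m where "m = a - c"
    have "m < n" using False ac by (auto simp: m_def)
    moreover have "m - c mod m \<le> m" "(n - a) mod m \<le> m"
      using ac by (auto simp: m_def intro: less_imp_le)
    ultimately obtain G where "regular_form m (m - c mod m) ((n - a) mod m) G"
      using less.IH by blast
    then interpret shift_extension n a c G using ac by unfold_locales (auto simp: m_def)
    show ?thesis using regular_form_F by blast
  qed
  consider "c < a" | "a < c" | "a = c" by linarith
  then show ?case
  proof cases
    case 2
    then show ?thesis using step regular_form_transpose less.prems by metis
  next
    case 3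
    then show ?thesis
      by (intro regular_form_symmetric) (auto simp: admissible_def seaweed_gcd_def)
  qed (use step less.prems in blast)
qed

section \<open>Determinants vanishing along curves\<close>

text \<open>Each coefficient of a product is a finite sum of products of coefficients, so this mode
  of convergence passes through the permutation expansion of a determinant.\<close>

definition coeffs_tendsto :: "('a \<Rightarrow> complex poly) \<Rightarrow> complex poly \<Rightarrow> 'a filter \<Rightarrow> bool" where
  "coeffs_tendsto P p Fl \<longleftrightarrow> (\<forall>k. ((\<lambda>e. coeff (P e) k) \<longlongrightarrow> coeff p k) Fl)"

lemma coeffs_tendsto_const: "coeffs_tendsto (\<lambda>e. p) p Fl"
  by (simp add: coeffs_tendsto_def)

lemma coeffs_tendsto_mult:
  "coeffs_tendsto P p Fl \<Longrightarrow> coeffs_tendsto Q q Fl \<Longrightarrow> coeffs_tendsto (\<lambda>e. P e * Q e) (p * q) Fl"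
  unfolding coeffs_tendsto_def coeff_mult by (auto intro!: tendsto_intros)

lemma coeffs_tendsto_prod:
  "(\<And>i. i \<in> I \<Longrightarrow> coeffs_tendsto (P i) (p i) Fl) \<Longrightarrow>
    coeffs_tendsto (\<lambda>e. \<Prod>i\<in>I. P i e) (\<Prod>i\<in>I. p i) Fl"
  by (induction I rule: infinite_finite_induct)
    (simp_all add: coeffs_tendsto_const coeffs_tendsto_mult)

lemma coeffs_tendsto_sum:
  "(\<And>i. i \<in> I \<Longrightarrow> coeffs_tendsto (P i) (p i) Fl) \<Longrightarrow>
    coeffs_tendsto (\<lambda>e. \<Sum>i\<in>I. P i e) (\<Sum>i\<in>I. p i) Fl"
  unfolding coeffs_tendsto_def coeff_sum by (auto intro!: tendsto_intros)

text \<open>The polynomial det(c + X b) in X. Its coefficient of degree \<open>k\<close> is the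
  Taylor term of order \<open>k\<close> of the determinant at \<open>c\<close> in direction
  \<open>b\<close>.\<close>

definition pencil :: "nat \<Rightarrow> (nat \<Rightarrow> nat \<Rightarrow> complex) \<Rightarrow> (nat \<Rightarrow> nat \<Rightarrow> complex) \<Rightarrow> complex poly" where
  "pencil N c b = det (mat N N (\<lambda>(i, j). [:c i j, b i j:]))"

lemma pencil_expand:
  "pencil N c b = (\<Sum>p | p permutes {0..<N}. signof p * (\<Prod>i = 0..<N. [:c i (p i), b i (p i):]))"
  unfolding pencil_def by (subst det_def'[of _ N]) (auto intro!: sum.cong prod.cong)

lemma poly_pencil: "poly (pencil N c b) z = det (mat N N (\<lambda>(i, j). c i j + z * b i j))"
proof -
  interpret ev: comm_ring_hom "\<lambda>p. poly p z" by unfold_locales auto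
  have "poly (pencil N c b) z = det (map_mat (\<lambda>p. poly p z) (mat N N (\<lambda>(i, j). [:c i j, b i j:])))"
    unfolding pencil_def by simp
  also have "map_mat (\<lambda>p. poly p z) (mat N N (\<lambda>(i, j). [:c i j, b i j:]))
      = mat N N (\<lambda>(i, j). c i j + z * b i j)"
    by (rule eq_matI) auto
  finally show ?thesis .
qed

lemma degree_pencil: "degree (pencil N c b) \<le> N"
proof -
  have "degree (pencil N c b) \<le> 1 * N"
    unfolding pencil_def by (rule degree_det_le) auto
  then show ?thesis by simp
qed

lemma coeffs_tendsto_pencil:
  assumes "\<And>i j. i < N \<Longrightarrow> j < N \<Longrightarrow> ((\<lambda>e. B e i j) \<longlongrightarrow> b i j) Fl"
  shows "coeffs_tendsto (\<lambda>e. pencil N c (B e)) (pencil N c b) Fl"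
proof -
  have "coeffs_tendsto (\<lambda>e. [:c i j, B e i j:]) [:c i j, b i j:] Fl" if "i < N" "j < N" for i j
    using assms[OF that] by (auto simp: coeffs_tendsto_def coeff_pCons split: nat.split)
  then show ?thesis
    unfolding pencil_expand
    by (intro coeffs_tendsto_sum coeffs_tendsto_mult coeffs_tendsto_const coeffs_tendsto_prod)
      auto
qed

text \<open>Only first-order information on the curves is available. It suffices because the lowest-order
  coefficient of the expansion of the determinant at \<open>c\<close>, taken over all directions at once, is
  already visible on the tangent vectors.\<close>
lemma det_zero_from_curves:
  fixes c b :: "nat \<Rightarrow> nat \<Rightarrow> complex"
  assumes curves: "\<And>b. b \<in> S \<Longrightarrow> \<exists>B. (\<forall>e. B e \<in> S) \<and>
       (\<forall>i<N. \<forall>j<N. ((\<lambda>e. B e i j) \<longlongrightarrow> b i j) (at_right (0::real))) \<and>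
       eventually (\<lambda>e. det (mat N N (\<lambda>(i, j). c i j + complex_of_real e * B e i j)) = 0) (at_right 0)"
    and b: "b \<in> S"
  shows "det (mat N N (\<lambda>(i, j). c i j + b i j)) = 0"
proof (rule ccontr)
  assume nz: "det (mat N N (\<lambda>(i, j). c i j + b i j)) \<noteq> 0"
  then have "poly (pencil N c b) 1 \<noteq> 0" by (simp add: poly_pencil)
  then have "pencil N c b \<noteq> 0" by auto
  then have ex: "\<exists>k. \<exists>b\<in>S. coeff (pencil N c b) k \<noteq> 0" using b leading_coeff_0_iff by blast
  \<comment> \<open>Minimality over all of \<open>S\<close> at once makes the lower coefficients
    vanish at every \<open>B e\<close>, not merely at the limit \<open>b1\<close>.\<close>
  define k where "k = (LEAST k. \<exists>b\<in>S. coeff (pencil N c b) k \<noteq> 0)"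
  obtain b1 where b1: "b1 \<in> S" "coeff (pencil N c b1) k \<noteq> 0"
    using LeastI_ex[OF ex] unfolding k_def by blast
  have low: "coeff (pencil N c b') i = 0" if "b' \<in> S" "i < k" for b' i
    using not_less_Least[of i "\<lambda>k. \<exists>b\<in>S. coeff (pencil N c b) k \<noteq> 0"] that unfolding k_def by blast
  have kN: "k \<le> N" using b1(2) degree_pencil le_degree order_trans by blast
  obtain B where B: "\<And>e. B e \<in> S"
      "\<And>i j. i < N \<Longrightarrow> j < N \<Longrightarrow> ((\<lambda>e. B e i j) \<longlongrightarrow> b1 i j) (at_right (0::real))"
    and ev: "eventually (\<lambda>e. det (mat N N (\<lambda>(i, j). c i j + complex_of_real e * B e i j)) = 0) (at_right 0)"
    using curves[OF b1(1)] by blast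
  \<comment> \<open>For small \<open>e\<close> this is the determinant on the curve divided by
    \<open>e ^ k\<close>. It is zero there, yet it tends to the nonzero coefficient at
    \<open>b1\<close>.\<close>
  define s where "s e = (\<Sum>i\<le>N - k. coeff (pencil N c (B e)) (i + k) * complex_of_real e ^ i)" for e
  have "((\<lambda>e. coeff (pencil N c (B e)) i) \<longlongrightarrow> coeff (pencil N c b1) i) (at_right 0)" for i
    using coeffs_tendsto_pencil[of N B b1 "at_right 0" c] B(2) by (auto simp: coeffs_tendsto_def)
  then have "(s \<longlongrightarrow> (\<Sum>i\<le>N - k. coeff (pencil N c b1) (i + k) * complex_of_real 0 ^ i)) (at_right 0)"
    unfolding s_def by (intro tendsto_intros) auto
  moreover have "(\<Sum>i\<le>N - k. coeff (pencil N c b1) (i + k) * complex_of_real 0 ^ i) = coeff (pencil N c b1) k"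
    by (simp add: power_0_left sum.atMost_shift)
  moreover have "eventually (\<lambda>e. s e = 0) (at_right 0)"
    using ev eventually_at_right_less[of "0::real"]
  proof eventually_elim
    case (elim e)
    have "0 = poly (pencil N c (B e)) (complex_of_real e)"
      using elim by (simp add: poly_pencil)
    also have "\<dots> = (\<Sum>i\<le>N. coeff (pencil N c (B e)) i * complex_of_real e ^ i)"
      unfolding poly_altdef using degree_pencil
      by (intro sum.mono_neutral_left) (auto simp: coeff_eq_0)
    also have "\<dots> = (\<Sum>i=k..N. coeff (pencil N c (B e)) i * complex_of_real e ^ i)"
    proof (rule sum.mono_neutral_right)
      show "\<forall>i\<in>{..N} - {k..N}. coeff (pencil N c (B e)) i * complex_of_real e ^ i = 0"
        using low[OF B(1)] by auto
    qed auto
    also have "\<dots> = (\<Sum>i\<le>N - k. coeff (pencil N c (B e)) (i + k) * complex_of_real e ^ (i + k))"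
      by (rule sum.reindex_bij_witness[of _ "\<lambda>i. i + k" "\<lambda>i. i - k"]) (use kN in auto)
    also have "\<dots> = complex_of_real e ^ k * s e"
      by (simp add: s_def sum_distrib_left power_add mult_ac)
    finally show ?case using elim by simp
  qed
  then have "(s \<longlongrightarrow> 0) (at_right 0)" by (rule tendsto_eventually)
  moreover have "at_right (0::real) \<noteq> bot" by simp
  ultimately show False using b1(2) tendsto_unique[of "at_right (0::real)" s] by auto
qed

section \<open>Matrix algebra and the coadjoint action\<close>

interpretation mv: vector_space cscale
  by unfold_locales (auto simp: fun_eq_iff algebra_simps)

interpretation functional: vector_space_pair cscale "(*) :: complex \<Rightarrow> complex \<Rightarrow> complex"
  by unfold_locales (auto simp: algebra_simps)

interpretation operator: vector_space_pair cscale cscale ..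

lemma sum_fun_apply: "(\<Sum>a\<in>I. f a) i j = (\<Sum>a\<in>I. f a i j)"
  for f :: "'a \<Rightarrow> nat \<Rightarrow> nat \<Rightarrow> complex"
  by (induction I rule: infinite_finite_induct) auto

definition idm :: "nat \<Rightarrow> nat \<Rightarrow> nat \<Rightarrow> complex" where
  "idm n i j = (if i = j \<and> i < n then 1 else 0)"

definition unit_mat :: "nat \<Rightarrow> nat \<Rightarrow> nat \<Rightarrow> nat \<Rightarrow> complex" where
  "unit_mat i j = (\<lambda>k l. if k = i \<and> l = j then 1 else 0)"

definition pairing :: "nat \<Rightarrow> (nat \<Rightarrow> nat \<Rightarrow> complex) \<Rightarrow> (nat \<Rightarrow> nat \<Rightarrow> complex) \<Rightarrow> complex" where
  "pairing n A B = (\<Sum>i<n. \<Sum>j<n. A i j * B j i)"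

text \<open>The coadjoint action on the functional \<open>trace (F _)\<close>. The trace pairing
  identifies the dual of the seaweed with the matrices supported at transposed positions; other
  entries are invisible to the seaweed and are cut off.\<close>

definition coad ::
  "nat \<Rightarrow> nat \<Rightarrow> nat \<Rightarrow> (nat \<Rightarrow> nat \<Rightarrow> complex) \<Rightarrow> (nat \<Rightarrow> nat \<Rightarrow> complex) \<Rightarrow> nat \<Rightarrow> nat \<Rightarrow> complex" where
  "coad n a c F x = (\<lambda>i j. if i < n \<and> j < n \<and> admissible a c j i then bracket n F x i j else 0)"

lemma mat_mul_assoc: "mat_mul n (mat_mul n A B) C = mat_mul n A (mat_mul n B C)"
proof (intro ext)
  fix i j
  have "mat_mul n (mat_mul n A B) C i j = (\<Sum>l<n. \<Sum>k<n. A i k * B k l * C l j)"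
    unfolding mat_mul_def sum_distrib_right ..
  moreover have "mat_mul n A (mat_mul n B C) i j = (\<Sum>k<n. \<Sum>l<n. A i k * B k l * C l j)"
    unfolding mat_mul_def sum_distrib_left mult.assoc ..
  moreover note sum.swap[of "\<lambda>l k. A i k * B k l * C l j" "{..<n}" "{..<n}"]
  ultimately show "mat_mul n (mat_mul n A B) C i j = mat_mul n A (mat_mul n B C) i j" by simp
qed

lemma mat_mul_add_left: "mat_mul n (A + B) C = mat_mul n A C + mat_mul n B C"
  by (simp add: mat_mul_def fun_eq_iff sum.distrib distrib_right)

lemma mat_mul_add_right: "mat_mul n A (B + C) = mat_mul n A B + mat_mul n A C"
  by (simp add: mat_mul_def fun_eq_iff sum.distrib distrib_left)

lemma mat_mul_scale_left: "mat_mul n (cscale z A) B = cscale z (mat_mul n A B)"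
  unfolding mat_mul_def sum_distrib_left mult.assoc ..

lemma mat_mul_scale_right: "mat_mul n A (cscale z B) = cscale z (mat_mul n A B)"
  unfolding mat_mul_def sum_distrib_left by (simp only: mult.left_commute[of _ z])

lemma bracket_eq: "bracket n A B = mat_mul n A B - mat_mul n B A"
  by (simp add: bracket_def fun_eq_iff)

lemma mat_mul_idm_left: "A \<in> mats n \<Longrightarrow> mat_mul n (idm n) A = A"
proof (intro ext)
  fix i j assume A: "A \<in> mats n"
  have "mat_mul n (idm n) A i j = (\<Sum>l<n. if l = i then A i j else 0)"
    unfolding mat_mul_def idm_def by (intro sum.cong) auto
  then show "mat_mul n (idm n) A i j = A i j" using A by (auto simp: mats_def)
qed

lemma mat_mul_idm_right: "A \<in> mats n \<Longrightarrow> mat_mul n A (idm n) = A"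
proof (intro ext)
  fix i j assume A: "A \<in> mats n"
  have "mat_mul n A (idm n) i j = (\<Sum>l<n. if l = j then A i j else 0)"
    unfolding mat_mul_def idm_def by (intro sum.cong) auto
  then show "mat_mul n A (idm n) i j = A i j" using A by (auto simp: mats_def)
qed

lemma mats_mult: "A \<in> mats n \<Longrightarrow> B \<in> mats n \<Longrightarrow> mat_mul n A B \<in> mats n"
  by (auto simp: mats_def mat_mul_def)

lemma gl_seaweed_mats: "x \<in> gl_seaweed n a c \<Longrightarrow> x \<in> mats n"
  by (simp add: gl_seaweed_def)

lemma gl_seaweed_mult:
  assumes "x \<in> gl_seaweed n a c" "y \<in> gl_seaweed n a c"
  shows "mat_mul n x y \<in> gl_seaweed n a c"
proof -
  have "admissible a c i j" if nz: "mat_mul n x y i j \<noteq> 0" for i j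
  proof -
    obtain l where "x i l * y l j \<noteq> 0"
      using nz unfolding mat_mul_def by (meson sum.neutral)
    then show ?thesis using assms admissible_trans[of a c i l j] unfolding gl_seaweed_def by auto
  qed
  then show ?thesis using assms mats_mult by (auto simp: gl_seaweed_def)
qed

lemma idm_gl_seaweed: "idm n \<in> gl_seaweed n a c"
  by (auto simp: gl_seaweed_def idm_def mats_def)

lemma subspace_gl_seaweed: "mv.subspace (gl_seaweed n a c)"
proof (rule mv.subspaceI)
  fix x y assume "x \<in> gl_seaweed n a c" "y \<in> gl_seaweed n a c"
  moreover have "x i j \<noteq> 0 \<or> y i j \<noteq> 0" if "x i j + y i j \<noteq> 0" for i j using that by auto
  ultimately show "x + y \<in> gl_seaweed n a c" unfolding gl_seaweed_def mats_def by fastforce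
qed (auto simp: gl_seaweed_def mats_def)

lemma bracket_scale_right: "bracket n F (cscale z x) = cscale z (bracket n F x)"
  by (simp add: bracket_eq mat_mul_scale_left mat_mul_scale_right fun_eq_iff algebra_simps)

lemma bracket_add_right: "bracket n F (x + y) = bracket n F x + bracket n F y"
  by (simp add: bracket_eq mat_mul_add_left mat_mul_add_right)

lemma bracket_scale_left: "bracket n (cscale z F) x = cscale z (bracket n F x)"
  by (simp add: bracket_eq mat_mul_scale_left mat_mul_scale_right fun_eq_iff algebra_simps)

lemma bracket_add_left: "bracket n (F + G) x = bracket n F x + bracket n G x"
  by (simp add: bracket_eq mat_mul_add_left mat_mul_add_right)

lemma linear_coad: "Vector_Spaces.linear cscale cscale (coad n a c F)"
  by unfold_locales
    (auto simp: coad_def fun_eq_iff bracket_add_right bracket_scale_right algebra_simps)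

lemma coad_add_left: "coad n a c (F + G) x = coad n a c F x + coad n a c G x"
  by (auto simp: coad_def fun_eq_iff bracket_add_left)

lemma coad_scale_left: "coad n a c (cscale z F) x = cscale z (coad n a c F x)"
  by (auto simp: coad_def fun_eq_iff bracket_scale_left)

lemma gl_kernel_iff: "x \<in> gl_kernel n a c F \<longleftrightarrow> x \<in> gl_seaweed n a c \<and> coad n a c F x = 0"
  by (auto simp: gl_kernel_def coad_def fun_eq_iff)

lemma subspace_gl_kernel: "mv.subspace (gl_kernel n a c F)"
proof -
  interpret l: Vector_Spaces.linear cscale cscale "coad n a c F" by (rule linear_coad)
  show ?thesis
    using subspace_gl_seaweed[of n a c]
    by (auto simp: mv.subspace_def gl_kernel_iff l.add l.scale l.zero fun_eq_iff)
qed

text \<open>If \<open>x l j\<close> is nonzero then \<open>(l, j)\<close> is admissible, and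
  transitivity with \<open>(j, i)\<close> makes \<open>(l, i)\<close> admissible. So the partner
  entry \<open>(i, l)\<close> is one where \<open>F\<close> and \<open>G\<close> agree.\<close>

lemma coad_cong:
  assumes x: "x \<in> gl_seaweed n a c"
    and FG: "\<And>i j. i < n \<Longrightarrow> j < n \<Longrightarrow> admissible a c j i \<Longrightarrow> F i j = G i j"
  shows "coad n a c F x = coad n a c G x"
proof -
  have "bracket n F x i j = bracket n G x i j" if ij: "i < n" "j < n" "admissible a c j i" for i j
  proof -
    have "F i l * x l j = G i l * x l j" if "l < n" for l
      using x ij that FG[of i l] admissible_trans[of a c l j i] by (cases "x l j = 0") (auto simp: gl_seaweed_def)
    moreover have "x i l * F l j = x i l * G l j" if "l < n" for l
      using x ij that FG[of l j] admissible_trans[of a c j i l] by (cases "x i l = 0") (auto simp: gl_seaweed_def)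
    ultimately show ?thesis
      unfolding bracket_def mat_mul_def by (intro arg_cong2[of _ _ _ _ "(-)"] sum.cong) auto
  qed
  then show ?thesis by (auto simp: coad_def fun_eq_iff)
qed

lemma mats_expand:
  assumes "x \<in> mats n"
  shows "x = (\<Sum>i<n. \<Sum>j<n. cscale (x i j) (unit_mat i j))"
proof (intro ext)
  fix k l
  have "(\<Sum>i<n. \<Sum>j<n. cscale (x i j) (unit_mat i j)) k l
      = (\<Sum>i<n. if i = k then (\<Sum>j<n. if j = l then x k l else 0) else 0)"
    unfolding sum_fun_apply by (intro sum.cong) (auto simp: unit_mat_def if_distrib cong: if_cong)
  then show "x k l = (\<Sum>i<n. \<Sum>j<n. cscale (x i j) (unit_mat i j)) k l"
    using assms by (auto simp: mats_def)
qed

lemma functional_expand: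
  assumes "Vector_Spaces.linear cscale (*) \<gamma>" "x \<in> mats n"
  shows "\<gamma> x = (\<Sum>i<n. \<Sum>j<n. x i j * \<gamma> (unit_mat i j))"
proof -
  interpret l: Vector_Spaces.linear cscale "(*)" \<gamma> by (rule assms(1))
  show ?thesis by (subst mats_expand[OF assms(2)]) (simp add: l.sum l.scale)
qed

lemma mats_spanned: "mats n \<subseteq> mv.span ((\<lambda>(i, j). unit_mat i j) ` ({..<n} \<times> {..<n}))"
proof
  fix x assume "x \<in> mats n"
  then show "x \<in> mv.span ((\<lambda>(i, j). unit_mat i j) ` ({..<n} \<times> {..<n}))"
    by (subst mats_expand, assumption)
      (rule mv.span_sum, rule mv.span_sum, rule mv.span_scale, rule mv.span_base, auto)
qed

lemma finite_independent_mats: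
  assumes "mv.independent S" "S \<subseteq> mats n"
  shows "finite S"
  using mv.independent_span_bound[OF _ assms(1), of "(\<lambda>(i, j). unit_mat i j) ` ({..<n} \<times> {..<n})"]
    mats_spanned assms(2) by blast

section \<open>The trace pairing and the image of the coadjoint map\<close>

lemma pairing_commute: "pairing n A B = pairing n B A"
  unfolding pairing_def by (subst sum.swap) (simp add: mult.commute)

lemma pairing_assoc: "pairing n (mat_mul n A B) C = pairing n A (mat_mul n B C)"
proof -
  have "pairing n (mat_mul n A B) C = (\<Sum>i<n. \<Sum>j<n. \<Sum>l<n. A i l * B l j * C j i)"
    unfolding pairing_def mat_mul_def sum_distrib_right ..
  also have "\<dots> = (\<Sum>i<n. \<Sum>l<n. \<Sum>j<n. A i l * B l j * C j i)"
    by (intro sum.cong sum.swap refl)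
  also have "\<dots> = pairing n A (mat_mul n B C)"
    unfolding pairing_def mat_mul_def sum_distrib_left mult.assoc ..
  finally show ?thesis .
qed

lemma pairing_diff_left: "pairing n (A - B) C = pairing n A C - pairing n B C"
  by (simp add: pairing_def left_diff_distrib sum_subtractf)

lemma pairing_diff_right: "pairing n C (A - B) = pairing n C A - pairing n C B"
  by (simp add: pairing_def right_diff_distrib sum_subtractf)

lemma pairing_bracket: "pairing n (bracket n F u) x = pairing n F (bracket n u x)"
proof -
  have "pairing n (mat_mul n u F) x = pairing n F (mat_mul n x u)"
    by (metis pairing_assoc pairing_commute)
  then show ?thesis
    by (simp add: bracket_eq pairing_diff_left pairing_diff_right pairing_assoc)
qed

lemma pairing_bracket_swap: "pairing n (bracket n F u) x = - pairing n (bracket n F x) u"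
  unfolding pairing_bracket by (simp add: bracket_eq pairing_diff_right)

lemma pairing_unit_mat: "i < n \<Longrightarrow> j < n \<Longrightarrow> pairing n A (unit_mat j i) = A i j"
proof -
  assume ij: "i < n" "j < n"
  have "pairing n A (unit_mat j i) = (\<Sum>k<n. if k = i then (\<Sum>l<n. if l = j then A i j else 0) else 0)"
    unfolding pairing_def by (intro sum.cong) (auto simp: unit_mat_def if_distrib cong: if_cong)
  then show ?thesis using ij by simp
qed

lemma separating_functional:
  assumes "mv.subspace S" "y \<notin> S"
  obtains \<gamma> where "Vector_Spaces.linear cscale (*) \<gamma>" "\<And>s. s \<in> S \<Longrightarrow> \<gamma> s = 0" "\<gamma> y = 1"
proof -
  obtain b where b: "b \<subseteq> S" "mv.independent b" "S \<subseteq> mv.span b"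
    using mv.maximal_independent_subset by blast
  have yb: "y \<notin> mv.span b" using mv.span_minimal[OF b(1) assms(1)] assms(2) by blast
  then have "mv.independent (insert y b)" using b(2) by (rule mv.independent_insertI)
  then obtain \<gamma> where \<gamma>: "Vector_Spaces.linear cscale (*) \<gamma>" "\<forall>x\<in>insert y b. \<gamma> x = (if x = y then 1 else 0)"
    using functional.linear_independent_extend[of "insert y b" "\<lambda>x. if x = y then 1 else 0"] by blast
  have "y \<notin> b" using yb mv.span_base by blast
  then have "\<gamma> x = 0" if "x \<in> b" for x using \<gamma>(2) that by auto
  then have "\<gamma> s = 0" if "s \<in> S" for s
    using functional.linear_eq_0_on_span[OF \<gamma>(1), of b s] b(3) that by blast
  then show ?thesis using that \<gamma> by auto
qed

text \<open>Otherwise some functional kills the image but not the target. The pairing represents it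
  by a seaweed element \<open>x\<close>, and since \<open>pairing n (bracket n F u) x\<close> is
  skew in \<open>u\<close> and \<open>x\<close>, this \<open>x\<close> lies in the kernel of
  \<open>F\<close>. It is therefore diagonal and cannot detect a matrix with zero diagonal.\<close>

lemma coad_surj:
  assumes F: "regular_form n a c F" and H: "\<And>i. H i i = 0"
  obtains u where "u \<in> gl_seaweed n a c"
    "\<And>i j. i < n \<Longrightarrow> j < n \<Longrightarrow> admissible a c j i \<Longrightarrow> bracket n F u i j = H i j"
proof -
  define y where "y = (\<lambda>i j. if i < n \<and> j < n \<and> admissible a c j i then H i j else 0)"
  interpret l: Vector_Spaces.linear cscale cscale "coad n a c F" by (rule linear_coad)
  have "y \<in> coad n a c F ` gl_seaweed n a c"
  proof (rule ccontr)
    assume "y \<notin> coad n a c F ` gl_seaweed n a c"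
    moreover have "mv.subspace (coad n a c F ` gl_seaweed n a c)"
      using l.subspace_image subspace_gl_seaweed by blast
    ultimately obtain \<gamma> where \<gamma>: "Vector_Spaces.linear cscale (*) \<gamma>" "\<gamma> y = 1"
      "\<And>u. u \<in> gl_seaweed n a c \<Longrightarrow> \<gamma> (coad n a c F u) = 0"
      using separating_functional by (metis (no_types, lifting) imageI)
    define x where "x = (\<lambda>i j. if i < n \<and> j < n \<and> admissible a c i j then \<gamma> (unit_mat j i) else 0)"
    have xq: "x \<in> gl_seaweed n a c" by (auto simp: gl_seaweed_def x_def mats_def)
    have "pairing n (bracket n F u) x = 0" if "u \<in> gl_seaweed n a c" for u
    proof -
      have "pairing n (bracket n F u) x = (\<Sum>i<n. \<Sum>j<n. coad n a c F u i j * \<gamma> (unit_mat i j))"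
        unfolding pairing_def by (intro sum.cong) (auto simp: x_def coad_def)
      also have "\<dots> = \<gamma> (coad n a c F u)"
        by (rule functional_expand[symmetric, OF \<gamma>(1)]) (auto simp: mats_def coad_def)
      finally show ?thesis using \<gamma>(3)[OF that] by simp
    qed
    then have "pairing n (bracket n F x) u = 0" if "u \<in> gl_seaweed n a c" for u
      using pairing_bracket_swap[of n F u x] that by simp
    moreover have "unit_mat j i \<in> gl_seaweed n a c" if "i < n" "j < n" "admissible a c j i" for i j
      using that by (auto simp: gl_seaweed_def unit_mat_def mats_def)
    ultimately have "bracket n F x i j = 0" if "i < n" "j < n" "admissible a c j i" for i j
      using pairing_unit_mat that by metis
    then have "x \<in> gl_kernel n a c F" using xq by (simp add: gl_kernel_def)
    then have offdiag: "x j i = 0" if "i \<noteq> j" for i j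
      using that F by (auto simp: regular_form_def periodic_diag_def)
    have zero: "y i j * \<gamma> (unit_mat i j) = 0" if "i < n" "j < n" for i j
      using that H offdiag[of i j] by (cases "i = j") (auto simp: y_def x_def split: if_splits)
    have "\<gamma> y = (\<Sum>i<n. \<Sum>j<n. y i j * \<gamma> (unit_mat i j))"
      by (rule functional_expand[OF \<gamma>(1)]) (auto simp: mats_def y_def)
    also have "\<dots> = 0"
      using zero by (intro sum.neutral ballI) (auto simp del: mult_eq_0_iff)
    finally have "\<gamma> y = 0" .
    then show False using \<gamma>(2) by simp
  qed
  then obtain u where u: "u \<in> gl_seaweed n a c" "y = coad n a c F u" by blast
  have "bracket n F u i j = H i j" if "i < n" "j < n" "admissible a c j i" for i j
    using fun_cong[OF fun_cong[OF u(2)], of i j] that by (simp add: y_def coad_def)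
  then show ?thesis using u(1) that by blast
qed

section \<open>Inverses near the identity\<close>

definition mnorm :: "nat \<Rightarrow> (nat \<Rightarrow> nat \<Rightarrow> complex) \<Rightarrow> real" where
  "mnorm n A = (\<Sum>i<n. \<Sum>j<n. cmod (A i j))"

lemma mnorm_nonneg: "0 \<le> mnorm n A"
  by (simp add: mnorm_def sum_nonneg)

lemma mnorm_triangle: "mnorm n (A + B) \<le> mnorm n A + mnorm n B"
  unfolding mnorm_def sum.distrib[symmetric] plus_fun_apply by (intro sum_mono norm_triangle_ineq)

lemma mnorm_scale: "mnorm n (cscale z A) = cmod z * mnorm n A"
  unfolding mnorm_def norm_mult sum_distrib_left ..

lemma cmod_le_mnorm:
  assumes "A \<in> mats n"
  shows "cmod (A i j) \<le> mnorm n A"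
proof (cases "i < n \<and> j < n")
  case True
  have "cmod (A i j) \<le> (\<Sum>j<n. cmod (A i j))"
    using True by (intro member_le_sum) auto
  also have "\<dots> \<le> mnorm n A"
    unfolding mnorm_def using True
    by (intro member_le_sum[of i "{..<n}" "\<lambda>i. \<Sum>j<n. cmod (A i j)"]) (auto simp: sum_nonneg)
  finally show ?thesis .
next
  case False
  then show ?thesis using assms mnorm_nonneg by (auto simp: mats_def)
qed

lemma mnorm_mult: "mnorm n (mat_mul n A B) \<le> mnorm n A * mnorm n B"
proof -
  have col: "(\<Sum>j<n. cmod (B l j)) \<le> mnorm n B" if "l < n" for l
    unfolding mnorm_def using that
    by (intro member_le_sum[of l "{..<n}" "\<lambda>l. \<Sum>j<n. cmod (B l j)"]) (auto simp: sum_nonneg)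
  have "mnorm n (mat_mul n A B) \<le> (\<Sum>i<n. \<Sum>j<n. \<Sum>l<n. cmod (A i l) * cmod (B l j))"
    unfolding mnorm_def mat_mul_def norm_mult[symmetric] by (intro sum_mono norm_sum)
  also have "\<dots> = (\<Sum>i<n. \<Sum>l<n. cmod (A i l) * (\<Sum>j<n. cmod (B l j)))"
    unfolding sum_distrib_left by (intro sum.cong sum.swap refl)
  also have "\<dots> \<le> (\<Sum>i<n. \<Sum>l<n. cmod (A i l) * mnorm n B)"
    using col by (intro sum_mono mult_left_mono) auto
  also have "\<dots> = mnorm n A * mnorm n B"
    unfolding mnorm_def sum_distrib_right ..
  finally show ?thesis .
qed

lemma injective_endomorphism_onto:
  assumes f: "Vector_Spaces.linear cscale cscale f" and V: "mv.subspace V" "V \<subseteq> mats n"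
    and fV: "f ` V \<subseteq> V" and inj: "\<And>x. x \<in> V \<Longrightarrow> f x = 0 \<Longrightarrow> x = 0"
  shows "f ` V = V"
proof -
  interpret l: Vector_Spaces.linear cscale cscale f by (rule f)
  obtain b where b: "b \<subseteq> V" "mv.independent b" "V \<subseteq> mv.span b"
    using mv.maximal_independent_subset by blast
  have Vb: "V = mv.span b" using b mv.span_minimal[OF b(1) V(1)] by blast
  have fin: "finite b" using finite_independent_mats b V by blast
  have inj': "inj_on f V"
    using l.inj_on_iff_eq_0[OF V(1)] inj by blast
  have ind: "mv.independent (f ` b)"
    by (rule l.independent_inj_on_image[OF b(2) inj'[unfolded Vb]])
  have card: "card (f ` b) = card b" by (rule card_image[OF inj_on_subset[OF inj' b(1)]])
  have "y \<in> mv.span (f ` b)" if "y \<in> V" for y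
  proof (rule ccontr)
    assume y: "y \<notin> mv.span (f ` b)"
    then have "mv.independent (insert y (f ` b))" using ind by (rule mv.independent_insertI)
    moreover have "insert y (f ` b) \<subseteq> mv.span b" using that fV b(1) Vb by auto
    ultimately have "card (insert y (f ` b)) \<le> card b" using mv.independent_span_bound[OF fin] by blast
    moreover have "y \<notin> f ` b" using y mv.span_base by blast
    ultimately show False using card fin by simp
  qed
  then show ?thesis using fV Vb l.span_image[of b] by auto
qed

lemma linear_mat_mul: "Vector_Spaces.linear cscale cscale (mat_mul n A)"
  by unfold_locales (simp_all add: mat_mul_add_right mat_mul_scale_right)

text \<open>Write \<open>g = idm n + z u\<close>. From \<open>y = g y - z u y\<close>, where the
  last term costs at most half of \<open>mnorm n y\<close>, follows
  \<open>mnorm n y \<le> 2 * mnorm n (g y)\<close>. So multiplication by \<open>g\<close> is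
  injective, hence onto within the seaweed, which places the inverse there. The same estimate at
  \<open>v\<close> bounds \<open>v - idm n = - z u v\<close>.\<close>

lemma near_identity_inverse:
  assumes u: "u \<in> gl_seaweed n a c" and small: "cmod z * mnorm n u \<le> 1 / 2"
  obtains v where "v \<in> gl_seaweed n a c"
    "mat_mul n (idm n + cscale z u) v = idm n" "mat_mul n v (idm n + cscale z u) = idm n"
    "mnorm n (v - idm n) \<le> cmod z * (2 * mnorm n u * mnorm n (idm n))"
proof -
  let ?g = "idm n + cscale z u" and ?q = "gl_seaweed n a c"
  note q = subspace_gl_seaweed[of n a c]
  have gq: "?g \<in> ?q" using mv.subspace_add[OF q idm_gl_seaweed mv.subspace_scale[OF q u]] .
  have gy: "mat_mul n ?g y = y + cscale z (mat_mul n u y)" if "y \<in> mats n" for y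
    using that by (simp add: mat_mul_add_left mat_mul_idm_left mat_mul_scale_left)
  have bound: "mnorm n y \<le> 2 * mnorm n (mat_mul n ?g y)" if y: "y \<in> mats n" for y
  proof -
    have "y = mat_mul n ?g y + cscale (- z) (mat_mul n u y)"
      using gy[OF y] by (simp add: fun_eq_iff)
    then have "mnorm n y \<le> mnorm n (mat_mul n ?g y) + cmod z * mnorm n (mat_mul n u y)"
      by (metis mnorm_triangle mnorm_scale norm_minus_cancel)
    also have "cmod z * mnorm n (mat_mul n u y) \<le> (cmod z * mnorm n u) * mnorm n y"
      using mnorm_mult[of n u y] by (simp add: mult.assoc mult_left_mono)
    also have "\<dots> \<le> 1 / 2 * mnorm n y"
      using small mnorm_nonneg by (intro mult_right_mono)
    finally show ?thesis by linarith
  qed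
  have inj: "y = 0" if "y \<in> mats n" "mat_mul n ?g y = 0" for y
  proof -
    have "mnorm n y \<le> 0" using bound[OF that(1)] that(2) by (simp add: mnorm_def)
    then have "cmod (y i j) \<le> 0" for i j using cmod_le_mnorm[OF that(1)] order_trans by blast
    then show ?thesis by (simp add: fun_eq_iff)
  qed
  have "mat_mul n ?g ` ?q = ?q"
  proof (rule injective_endomorphism_onto[OF linear_mat_mul q])
    show "?q \<subseteq> mats n" using gl_seaweed_mats by blast
    show "mat_mul n ?g ` ?q \<subseteq> ?q" using gl_seaweed_mult[OF gq] by blast
    show "y = 0" if "y \<in> ?q" "mat_mul n ?g y = 0" for y using inj gl_seaweed_mats that by blast
  qed
  then obtain v where v: "v \<in> ?q" "mat_mul n ?g v = idm n"
    using idm_gl_seaweed by (metis imageE)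
  have vm: "v \<in> mats n" and gm: "?g \<in> mats n" and im: "idm n \<in> mats n"
    using v(1) gq idm_gl_seaweed gl_seaweed_mats by blast+
  have "mat_mul n ?g (mat_mul n v ?g - idm n) = 0"
  proof -
    interpret l: Vector_Spaces.linear cscale cscale "mat_mul n ?g" by (rule linear_mat_mul)
    have "mat_mul n ?g (mat_mul n v ?g) = ?g"
      unfolding mat_mul_assoc[symmetric] v(2) by (rule mat_mul_idm_left[OF gm])
    then show ?thesis unfolding l.diff using mat_mul_idm_right[OF gm] by simp
  qed
  moreover have "mat_mul n v ?g - idm n \<in> mats n"
    using mats_mult[OF vm gm] im by (auto simp: mats_def)
  ultimately have "mat_mul n v ?g - idm n = 0" by (rule inj[rotated])
  then have left: "mat_mul n v ?g = idm n" by simp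
  have "v - idm n = cscale (- z) (mat_mul n u v)"
    using gy[OF vm] v(2) by (simp add: fun_eq_iff)
  then have "mnorm n (v - idm n) = cmod z * mnorm n (mat_mul n u v)"
    by (simp only: mnorm_scale norm_minus_cancel)
  also have "\<dots> \<le> cmod z * (mnorm n u * mnorm n v)"
    using mnorm_mult by (intro mult_left_mono) auto
  also have "\<dots> \<le> cmod z * (mnorm n u * (2 * mnorm n (idm n)))"
    using bound[OF vm] v(2) mnorm_nonneg by (intro mult_left_mono) auto
  finally show ?thesis using that[OF v left] by (simp add: mult_ac)
qed

lemma tendsto_mat_mul:
  assumes "\<And>i j. ((\<lambda>e. A e i j) \<longlongrightarrow> A0 i j) Fl" "\<And>i j. ((\<lambda>e. B e i j) \<longlongrightarrow> B0 i j) Fl"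
  shows "((\<lambda>e. mat_mul n (A e) (B e) i j) \<longlongrightarrow> mat_mul n A0 B0 i j) Fl"
  unfolding mat_mul_def by (intro tendsto_intros assms)

lemma periodic_diag_commute:
  assumes F: "\<And>i j. F i j \<noteq> 0 \<Longrightarrow> i < n \<and> j < n \<and> i mod g = j mod g"
    and t: "t \<in> periodic_diag n g"
  shows "mat_mul n F t = mat_mul n t F"
proof (intro ext)
  fix i j
  have toff: "\<And>i j. i \<noteq> j \<Longrightarrow> t i j = 0" and tper: "\<And>i j. i < n \<Longrightarrow> j < n \<Longrightarrow> i mod g = j mod g \<Longrightarrow> t i i = t j j"
    and tm: "t \<in> mats n"
    using t unfolding periodic_diag_def by blast+
  show "mat_mul n F t i j = mat_mul n t F i j"
  proof (cases "i < n \<and> j < n")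
    case True
    then have "bracket n F t i j = F i j * (t j j - t i i)"
      by (intro bracket_diagonal_right toff) auto
    also have "\<dots> = 0" using F[of i j] tper[of i j] by (cases "F i j = 0") auto
    finally show ?thesis by (simp add: bracket_def)
  next
    case False
    have "F k l = 0" if "n \<le> k \<or> n \<le> l" for k l using F[of k l] that by force
    then have "F \<in> mats n" by (simp add: mats_def)
    then have "mat_mul n F t \<in> mats n" "mat_mul n t F \<in> mats n" using tm mats_mult by blast+
    then show ?thesis using False unfolding mats_def by auto
  qed
qed

text \<open>The functionals near \<open>F\<close> whose kernel contains a conjugate of the torus \<open>periodic_diag\<close> are,
  to first order, all functionals: conjugating \<open>F\<close> yields the directions \<open>[F, u]\<close>, which together
  with the diagonal directions fill the dual space.\<close>
lemma conjugate_curve: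
  assumes F: "regular_form n a c F"
  obtains H :: "real \<Rightarrow> nat \<Rightarrow> nat \<Rightarrow> complex" and h0 where
    "\<And>i j. i < n \<Longrightarrow> j < n \<Longrightarrow> admissible a c j i \<Longrightarrow> h0 i j = h i j"
    "\<And>i j. ((\<lambda>e. H e i j) \<longlongrightarrow> h0 i j) (at_right 0)"
    "eventually (\<lambda>e. \<exists>v g. v \<in> gl_seaweed n a c \<and> g \<in> gl_seaweed n a c \<and>
       mat_mul n g v = idm n \<and> mat_mul n v g = idm n \<and>
       (\<forall>t \<in> periodic_diag n (seaweed_gcd n a c).
          mat_mul n v (mat_mul n t g) \<in> gl_kernel n a c (F + cscale (complex_of_real e) (H e)))) (at_right 0)"
proof -
  let ?q = "gl_seaweed n a c"
  obtain u where u: "u \<in> ?q"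
    "\<And>i j. i < n \<Longrightarrow> j < n \<Longrightarrow> admissible a c j i \<Longrightarrow> bracket n F u i j = (if i = j then 0 else h i j)"
    using coad_surj[OF F, of "\<lambda>i j. if i = j then 0 else h i j"] by auto
  \<comment> \<open>The diagonal part of \<open>h\<close>, which \<open>coad_surj\<close> leaves
    out. It commutes with the torus, so it may be added to \<open>F\<close> before
    conjugating.\<close>
  define W where "W = (\<lambda>i j. if i = j \<and> i < n then h i i else 0)"
  define P where "P = bracket n F u"
  define g where "g e = idm n + cscale (complex_of_real e) u" for e
  have Fsupp: "\<And>i j. F i j \<noteq> 0 \<Longrightarrow> i < n \<and> j < n \<and> i mod seaweed_gcd n a c = j mod seaweed_gcd n a c"
    using F unfolding regular_form_def by blast
  have "F i j = 0" if "n \<le> i \<or> n \<le> j" for i j using Fsupp[of i j] that by force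
  then have Fm: "F \<in> mats n" by (simp add: mats_def)
  have Wm: "W \<in> mats n" by (auto simp: mats_def W_def)
  have gq: "g e \<in> ?q" for e
    unfolding g_def
    by (intro mv.subspace_add[OF subspace_gl_seaweed] idm_gl_seaweed mv.subspace_scale[OF subspace_gl_seaweed] u(1))
  define small where "small e \<longleftrightarrow> 0 < e \<and> e * mnorm n u \<le> 1 / 2" for e :: real
  have ev: "eventually small (at_right 0)"
  proof -
    have "((\<lambda>e. e * mnorm n u) \<longlongrightarrow> 0 * mnorm n u) (at_right (0::real))" by (intro tendsto_intros)
    then have "eventually (\<lambda>e. e * mnorm n u < 1 / 2) (at_right (0::real))"
      by (rule order_tendstoD) simp
    then show ?thesis
      using eventually_at_right_less[of "0::real"] by eventually_elim (simp add: small_def)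
  qed
  have "\<exists>v. small e \<longrightarrow> v \<in> ?q \<and> mat_mul n (g e) v = idm n \<and> mat_mul n v (g e) = idm n \<and>
      mnorm n (v - idm n) \<le> e * (2 * mnorm n u * mnorm n (idm n))" for e
  proof (cases "small e")
    case True
    then have "cmod (complex_of_real e) * mnorm n u \<le> 1 / 2" by (simp add: small_def)
    then show ?thesis
      using near_identity_inverse[OF u(1), of "complex_of_real e"] True unfolding g_def small_def
      by (metis abs_of_pos norm_of_real)
  qed simp
  then obtain v where v: "\<And>e. small e \<Longrightarrow> v e \<in> ?q" "\<And>e. small e \<Longrightarrow> mat_mul n (g e) (v e) = idm n"
      "\<And>e. small e \<Longrightarrow> mat_mul n (v e) (g e) = idm n"
      "\<And>e. small e \<Longrightarrow> mnorm n (v e - idm n) \<le> e * (2 * mnorm n u * mnorm n (idm n))"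
    by metis
  \<comment> \<open>Chosen so that \<open>F + e H e = v (F + e W) g\<close> holds exactly:
    \<open>g = idm n + e u\<close> gives \<open>F g = g F + e P\<close>, and
    \<open>v g = idm n\<close>.\<close>
  define H where "H e = mat_mul n (v e) (P + mat_mul n W (g e))" for e
  have Pm: "P \<in> mats n"
    unfolding P_def bracket_eq using mats_mult[OF Fm gl_seaweed_mats[OF u(1)]]
      mats_mult[OF gl_seaweed_mats[OF u(1)] Fm] by (auto simp: mats_def)
  have lim_g: "((\<lambda>e. g e i j) \<longlongrightarrow> idm n i j) (at_right 0)" for i j
  proof -
    have "((\<lambda>e. idm n i j + complex_of_real e * u i j) \<longlongrightarrow> idm n i j + complex_of_real 0 * u i j) (at_right 0)"
      by (intro tendsto_intros)
    then show ?thesis by (simp add: g_def)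
  qed
  have lim_v: "((\<lambda>e. v e i j) \<longlongrightarrow> idm n i j) (at_right 0)" for i j
  proof -
    have bound: "eventually (\<lambda>e. norm (v e i j - idm n i j) \<le> e * (2 * mnorm n u * mnorm n (idm n))) (at_right 0)"
      using ev
    proof eventually_elim
      case (elim e)
      have "v e - idm n \<in> mats n"
        using gl_seaweed_mats[OF v(1)[OF elim]] gl_seaweed_mats[OF idm_gl_seaweed, of n] by (auto simp: mats_def)
      then show ?case using cmod_le_mnorm[of "v e - idm n" n i j] v(4)[OF elim] by simp
    qed
    have "((\<lambda>e. e * (2 * mnorm n u * mnorm n (idm n))) \<longlongrightarrow> 0 * (2 * mnorm n u * mnorm n (idm n)))
        (at_right (0::real))"
      by (intro tendsto_intros)
    then have "((\<lambda>e. e * (2 * mnorm n u * mnorm n (idm n))) \<longlongrightarrow> 0) (at_right (0::real))" by simp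
    then have "((\<lambda>e. norm (v e i j - idm n i j)) \<longlongrightarrow> 0) (at_right 0)"
      by (rule tendsto_sandwich[OF always_eventually bound tendsto_const, rotated]) simp
    then have "((\<lambda>e. v e i j - idm n i j) \<longlongrightarrow> 0) (at_right 0)"
      by (rule tendsto_norm_zero_cancel)
    then show ?thesis by (rule LIM_zero_cancel)
  qed
  have "((\<lambda>e. (P + mat_mul n W (g e)) i j) \<longlongrightarrow> (P + mat_mul n W (idm n)) i j) (at_right 0)" for i j
    unfolding plus_fun_apply by (intro tendsto_intros tendsto_mat_mul lim_g)
  then have lim_H: "((\<lambda>e. H e i j) \<longlongrightarrow> mat_mul n (idm n) (P + mat_mul n W (idm n)) i j) (at_right 0)" for i j
    unfolding H_def by (intro tendsto_mat_mul lim_v)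
  have "P + W \<in> mats n" using Pm Wm by (auto simp: mats_def)
  then have "mat_mul n (idm n) (P + mat_mul n W (idm n)) = P + W"
    by (simp add: mat_mul_idm_right[OF Wm] mat_mul_idm_left)
  then have lim: "((\<lambda>e. H e i j) \<longlongrightarrow> (P + W) i j) (at_right 0)" for i j
    using lim_H by simp
  have agree: "(P + W) i j = h i j" if "i < n" "j < n" "admissible a c j i" for i j
    using u(2)[OF that] that by (simp add: P_def W_def)
  have kernel: "mat_mul n (v e) (mat_mul n t (g e)) \<in> gl_kernel n a c (F + cscale (complex_of_real e) (H e))"
    if e: "small e" and t: "t \<in> periodic_diag n (seaweed_gcd n a c)" for e t
  proof -
    let ?e = "complex_of_real e" and ?A = "F + cscale (complex_of_real e) W" and ?v = "v e" and ?g = "g e"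
    have tm: "t \<in> mats n" and tq: "t \<in> ?q"
      using t unfolding periodic_diag_def gl_seaweed_def by (auto, metis admissible_refl)
    have gm: "?g \<in> mats n" and vm: "?v \<in> mats n"
      using gq v(1)[OF e] gl_seaweed_mats by blast+
    have gv: "mat_mul n ?g (mat_mul n ?v x) = x" if "x \<in> mats n" for x
      unfolding mat_mul_assoc[symmetric] v(2)[OF e] by (rule mat_mul_idm_left[OF that])
    have vg: "mat_mul n ?v (mat_mul n ?g x) = x" if "x \<in> mats n" for x
      unfolding mat_mul_assoc[symmetric] v(3)[OF e] by (rule mat_mul_idm_left[OF that])
    have "mat_mul n ?A ?g = mat_mul n F ?g + cscale ?e (mat_mul n W ?g)"
      by (simp only: mat_mul_add_left mat_mul_scale_left)
    moreover have "mat_mul n F ?g = F + cscale ?e (mat_mul n F u)"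
      by (simp only: g_def mat_mul_add_right mat_mul_scale_right mat_mul_idm_right[OF Fm])
    moreover have "mat_mul n ?g F = F + cscale ?e (mat_mul n u F)"
      by (simp only: g_def mat_mul_add_left mat_mul_scale_left mat_mul_idm_left[OF Fm])
    ultimately have "mat_mul n ?A ?g = mat_mul n ?g F + cscale ?e (P + mat_mul n W ?g)"
      by (intro ext) (simp only: P_def bracket_def plus_fun_apply ring_distribs, simp)
    then have "mat_mul n ?v (mat_mul n ?A ?g) = F + cscale ?e (H e)"
      by (simp only: H_def mat_mul_add_right[of n ?v "mat_mul n ?g F"] mat_mul_scale_right vg[OF Fm])
    then have Fe: "F + cscale ?e (H e) = mat_mul n ?v (mat_mul n ?A ?g)" ..
    have "mat_mul n W t = mat_mul n t W"
      by (rule periodic_diag_commute[OF _ t]) (auto simp: W_def split: if_splits)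
    moreover have "mat_mul n F t = mat_mul n t F"
      using Fsupp t by (rule periodic_diag_commute)
    ultimately have At: "mat_mul n ?A t = mat_mul n t ?A"
      by (simp only: mat_mul_add_left mat_mul_add_right mat_mul_scale_left mat_mul_scale_right)
    have Am: "?A \<in> mats n" using Fm Wm by (auto simp: mats_def)
    have "mat_mul n (mat_mul n ?v (mat_mul n ?A ?g)) (mat_mul n ?v (mat_mul n t ?g))
        = mat_mul n ?v (mat_mul n (mat_mul n ?A t) ?g)"
      by (simp only: mat_mul_assoc gv[OF mats_mult[OF tm gm]])
    moreover have "mat_mul n (mat_mul n ?v (mat_mul n t ?g)) (mat_mul n ?v (mat_mul n ?A ?g))
        = mat_mul n ?v (mat_mul n (mat_mul n t ?A) ?g)"
      by (simp only: mat_mul_assoc gv[OF mats_mult[OF Am gm]])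
    ultimately have "bracket n (F + cscale ?e (H e)) (mat_mul n ?v (mat_mul n t ?g)) = 0"
      unfolding Fe bracket_eq At by simp
    then show ?thesis
      using gl_seaweed_mult[OF v(1)[OF e] gl_seaweed_mult[OF tq gq]] by (simp add: gl_kernel_def)
  qed
  have "eventually (\<lambda>e. \<exists>v g. v \<in> ?q \<and> g \<in> ?q \<and> mat_mul n g v = idm n \<and> mat_mul n v g = idm n \<and>
       (\<forall>t \<in> periodic_diag n (seaweed_gcd n a c).
          mat_mul n v (mat_mul n t g) \<in> gl_kernel n a c (F + cscale (complex_of_real e) (H e)))) (at_right 0)"
    using ev by eventually_elim (use v gq kernel in blast)
  then show ?thesis using that[OF agree lim] by blast
qed

section \<open>The lower bound for kernels\<close>

definition class_idm :: "nat \<Rightarrow> nat \<Rightarrow> nat \<Rightarrow> nat \<Rightarrow> nat \<Rightarrow> complex" where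
  "class_idm n g k = (\<lambda>i j. if i = j \<and> i < n \<and> i mod g = k then 1 else 0)"

lemma class_idm_periodic: "class_idm n g k \<in> periodic_diag n g"
  by (auto simp: class_idm_def periodic_diag_def mats_def)

lemma class_idm_independent:
  assumes "g \<le> n"
  shows "mv.independent (class_idm n g ` {..<g})" "inj_on (class_idm n g) {..<g}"
proof -
  have entry: "class_idm n g k l l = (if k = l then 1 else 0)" if "k < g" "l < g" for k l
    using that assms by (auto simp: class_idm_def)
  show inj: "inj_on (class_idm n g) {..<g}"
    by (rule inj_onI) (metis entry lessThan_iff zero_neq_one)
  show "mv.independent (class_idm n g ` {..<g})"
  proof (rule mv.independent_if_scalars_zero)
    fix f x assume sum: "(\<Sum>x\<in>class_idm n g ` {..<g}. cscale (f x) x) = 0"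
      and x: "x \<in> class_idm n g ` {..<g}"
    obtain l where l: "l < g" "x = class_idm n g l" using x by blast
    have "0 = (\<Sum>k<g. cscale (f (class_idm n g k)) (class_idm n g k)) l l"
      using sum by (simp add: sum.reindex[OF inj])
    also have "\<dots> = (\<Sum>k<g. if k = l then f x else 0)"
      unfolding sum_fun_apply using entry l by (intro sum.cong) auto
    finally show "f x = 0" using l by simp
  qed simp
qed

lemma independent_union:
  assumes A: "mv.independent A" "finite A" and B: "mv.independent B" "finite B"
    and int: "mv.span A \<inter> mv.span B \<subseteq> {0}"
  shows "mv.independent (A \<union> B)" "A \<inter> B = {}"
proof -
  show disj: "A \<inter> B = {}"
  proof -
    have "x \<notin> B" if "x \<in> A" for x
    proof
      assume "x \<in> B"
      then have "x = 0" using int that mv.span_base by blast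
      then show False using mv.dependent_zero A(1) that by blast
    qed
    then show ?thesis by blast
  qed
  show "mv.independent (A \<union> B)"
  proof (rule mv.independent_if_scalars_zero)
    fix f x assume sum: "(\<Sum>x\<in>A \<union> B. cscale (f x) x) = 0" and x: "x \<in> A \<union> B"
    let ?a = "\<Sum>x\<in>A. cscale (f x) x" and ?b = "\<Sum>x\<in>B. cscale (f x) x"
    have ab: "?a + ?b = 0" using sum A(2) B(2) disj by (simp add: sum.union_disjoint)
    have sa: "?a \<in> mv.span A" and sb: "?b \<in> mv.span B"
      by (rule mv.span_sum, rule mv.span_scale, rule mv.span_base, assumption)+
    have "?a = - ?b" using ab by (rule eq_neg_iff_add_eq_0[THEN iffD2])
    then have "?a \<in> mv.span B" using mv.span_neg[OF sb] by simp
    then have a0: "?a = 0" using sa int by blast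
    then have b0: "?b = 0" using ab by simp
    show "f x = 0"
      using x mv.independentD[OF A(1,2) order_refl a0] mv.independentD[OF B(1,2) order_refl b0] by blast
  qed (use A B in simp)
qed

lemma spans_meet:
  assumes A: "mv.independent A" "finite A" and B: "mv.independent B" "finite B"
    and Z: "finite Z" "A \<subseteq> mv.span Z" "B \<subseteq> mv.span Z" and card: "card Z < card A + card B"
  obtains y where "y \<noteq> 0" "y \<in> mv.span A" "y \<in> mv.span B"
proof (rule ccontr)
  assume "\<not> thesis"
  then have int: "mv.span A \<inter> mv.span B \<subseteq> {0}" using that by blast
  note u = independent_union[OF A B int]
  have "card (A \<union> B) \<le> card Z"
    using mv.independent_span_bound[OF Z(1) u(1)] Z by blast
  then show False using card card_Un_disjoint[OF A(2) B(2) u(2)] by simp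
qed

text \<open>The linear map that is \<open>0\<close> on \<open>A\<close> and the identity on
  \<open>Z - A\<close> sends \<open>x\<close> both to \<open>0\<close> and to
  \<open>x\<close>.\<close>

lemma independent_complement_span:
  assumes Z: "mv.independent Z" and A: "A \<subseteq> Z"
    and x: "x \<in> mv.span (Z - A)" "x \<in> mv.span A"
  shows "x = 0"
proof -
  obtain f where f: "Vector_Spaces.linear cscale cscale f" "\<forall>z\<in>Z. f z = (if z \<in> A then 0 else z)"
    using operator.linear_independent_extend[OF Z, of "\<lambda>z. if z \<in> A then 0 else z"] by blast
  have "f x = 0"
    by (rule operator.linear_eq_0_on_span[OF f(1) _ x(2)]) (use f(2) A in auto)
  moreover have "f x = x"
  proof -
    have "Vector_Spaces.linear cscale cscale (\<lambda>x. x)" by unfold_locales simp_all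
    then show ?thesis
      by (rule operator.linear_eq_on[OF f(1) _ x(1)]) (use f(2) in auto)
  qed
  ultimately show ?thesis by simp
qed

lemma det_zero_if_kernel:
  fixes M :: "nat \<Rightarrow> nat \<Rightarrow> complex"
  assumes "\<And>i. i < N \<Longrightarrow> (\<Sum>j<N. M i j * d j) = 0" "k < N" "d k \<noteq> 0"
  shows "det (mat N N (\<lambda>(i, j). M i j)) = 0"
proof -
  let ?A = "mat N N (\<lambda>(i, j). M i j)"
  have "vec N d \<noteq> 0\<^sub>v N" using assms(2,3) by (metis index_vec index_zero_vec(1))
  moreover have "?A *\<^sub>v vec N d = 0\<^sub>v N"
    using assms(1) by (intro eq_vecI) (auto simp: scalar_prod_def lessThan_atLeast0)
  moreover have "vec N d \<in> carrier_vec N" by simp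
  moreover have "?A \<in> carrier_mat N N" by simp
  ultimately show ?thesis using det_0_iff_vec_prod_zero by blast
qed

lemma seaweed_gcd_bounds:
  assumes "0 < n"
  shows "0 < seaweed_gcd n a c" "seaweed_gcd n a c \<le> n"
proof -
  have "gcd (int n) (int a - int c) \<le> int n" using assms by (intro gcd_le1_int) simp
  then show "seaweed_gcd n a c \<le> n" by (simp add: seaweed_gcd_def)
  show "0 < seaweed_gcd n a c" using assms by (simp add: seaweed_gcd_def)
qed

text \<open>A conjugate of the torus \<open>periodic_diag\<close> meets the span of \<open>w\<close> for dimension reasons, and this
  makes the matrix of \<open>coad\<close> on \<open>w\<close> singular.\<close>
lemma coad_matrix_singular:
  assumes g: "g \<le> n" and v: "v \<in> gl_seaweed n a c" "h \<in> gl_seaweed n a c"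
    and hv: "mat_mul n h v = idm n" "mat_mul n v h = idm n"
    and ker: "\<forall>t \<in> periodic_diag n g. mat_mul n v (mat_mul n t h) \<in> gl_kernel n a c F"
    and Z: "finite Z" "gl_seaweed n a c \<subseteq> mv.span Z"
    and W: "mv.independent (w ` {..<N})" "inj_on w {..<N}" "w ` {..<N} \<subseteq> gl_seaweed n a c"
    and card: "card Z < N + g"
    and \<gamma>: "\<And>i. i < N \<Longrightarrow> Vector_Spaces.linear cscale (*) (\<gamma> i)"
  shows "det (mat N N (\<lambda>(i, j). \<gamma> i (coad n a c F (w j)))) = 0"
proof -
  define \<phi> where "\<phi> t = mat_mul n v (mat_mul n t h)" for t
  define C where "C = class_idm n g ` {..<g}"
  have hm: "h \<in> mats n" and vm: "v \<in> mats n" using v gl_seaweed_mats by blast+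
  have lin: "Vector_Spaces.linear cscale cscale \<phi>"
    unfolding \<phi>_def
    by unfold_locales (simp_all only: mat_mul_add_left mat_mul_add_right mat_mul_scale_left mat_mul_scale_right)
  interpret l: Vector_Spaces.linear cscale cscale \<phi> by (rule lin)
  have Csub: "C \<subseteq> periodic_diag n g" using class_idm_periodic by (auto simp: C_def)
  have Cm: "mv.span C \<subseteq> mats n"
  proof (rule mv.span_minimal)
    show "C \<subseteq> mats n" using Csub by (auto simp: periodic_diag_def)
    show "mv.subspace (mats n)" by (rule mv.subspaceI) (auto simp: mats_def)
  qed
  have "inj_on \<phi> (mv.span C)"
  proof (rule inj_on_inverseI[where g = "\<lambda>x. mat_mul n h (mat_mul n x v)"])
    fix t assume "t \<in> mv.span C"
    then have tm: "t \<in> mats n" using Cm by blast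
    have "mat_mul n h (mat_mul n (\<phi> t) v) = mat_mul n (mat_mul n h v) (mat_mul n t (mat_mul n h v))"
      by (simp only: \<phi>_def mat_mul_assoc)
    also have "\<dots> = t" by (simp only: hv mat_mul_idm_right[OF tm] mat_mul_idm_left[OF tm])
    finally show "mat_mul n h (mat_mul n (\<phi> t) v) = t" .
  qed
  then have ind: "mv.independent (\<phi> ` C)" and inj: "inj_on \<phi> C"
    using class_idm_independent(1)[OF g] l.independent_inj_on_image inj_on_subset mv.span_superset
    unfolding C_def by blast+
  have cardC: "card (\<phi> ` C) = g"
    using card_image[OF inj] card_image[OF class_idm_independent(2)[OF g]] by (simp add: C_def)
  have sub: "\<phi> ` C \<subseteq> gl_kernel n a c F" using ker Csub by (auto simp: \<phi>_def)
  have "gl_kernel n a c F \<subseteq> mv.span Z" using Z(2) by (auto simp: gl_kernel_def)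
  moreover have "card (w ` {..<N}) = N" using card_image[OF W(2)] by simp
  ultimately have "w ` {..<N} \<subseteq> mv.span Z" "\<phi> ` C \<subseteq> mv.span Z" "card Z < card (w ` {..<N}) + card (\<phi> ` C)"
    using W(3) Z(2) sub cardC card by (blast, blast, simp)
  then obtain y where y: "y \<noteq> 0" "y \<in> mv.span (w ` {..<N})" "y \<in> mv.span (\<phi> ` C)"
    using spans_meet[OF W(1) _ ind _ Z(1)] by (metis C_def finite_imageI finite_lessThan)
  have "y \<in> gl_kernel n a c F"
    using y(3) mv.span_minimal[OF sub subspace_gl_kernel] by blast
  then have cy: "coad n a c F y = 0" by (simp add: gl_kernel_iff)
  obtain d where "y = (\<Sum>x\<in>w ` {..<N}. cscale (d x) x)"
    using y(2) mv.span_finite[of "w ` {..<N}"] by auto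
  then have yd: "y = (\<Sum>j<N. cscale (d (w j)) (w j))" by (simp add: sum.reindex[OF W(2)])
  obtain k where k: "k < N" "d (w k) \<noteq> 0"
  proof (rule ccontr)
    assume "\<not> thesis"
    then have "\<And>j. j < N \<Longrightarrow> d (w j) = 0" using that by blast
    then have "y = 0" unfolding yd by (intro sum.neutral) (auto simp: fun_eq_iff)
    then show False using y(1) by simp
  qed
  interpret m: Vector_Spaces.linear cscale cscale "coad n a c F" by (rule linear_coad)
  show ?thesis
  proof (rule det_zero_if_kernel[where d = "\<lambda>j. d (w j)", OF _ k])
    fix i assume "i < N"
    then interpret \<gamma>: Vector_Spaces.linear cscale "(*)" "\<gamma> i" by (rule \<gamma>)
    have "(\<Sum>j<N. \<gamma> i (coad n a c F (w j)) * d (w j)) = \<gamma> i (coad n a c F y)"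
      unfolding yd m.sum m.scale \<gamma>.sum \<gamma>.scale by (simp only: mult.commute)
    then show "(\<Sum>j<N. \<gamma> i (coad n a c F (w j)) * d (w j)) = 0"
      unfolding cy \<gamma>.zero .
  qed
qed

lemma dual_functionals:
  assumes "mv.independent (f ` {..<N})" "inj_on f {..<N}"
  obtains \<gamma> :: "nat \<Rightarrow> (nat \<Rightarrow> nat \<Rightarrow> complex) \<Rightarrow> complex" where
    "\<And>i. Vector_Spaces.linear cscale (*) (\<gamma> i)"
    "\<And>i j. i < N \<Longrightarrow> j < N \<Longrightarrow> \<gamma> i (f j) = (if i = j then 1 else 0)"
proof -
  have "\<exists>\<gamma>. Vector_Spaces.linear cscale (*) \<gamma> \<and>
      (\<forall>x\<in>f ` {..<N}. \<gamma> x = (if x = f i then 1 else (0::complex)))" for i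
    by (rule functional.linear_independent_extend[OF assms(1)])
  then obtain \<gamma> :: "nat \<Rightarrow> (nat \<Rightarrow> nat \<Rightarrow> complex) \<Rightarrow> complex" where
    \<gamma>: "\<And>i. Vector_Spaces.linear cscale (*) (\<gamma> i)"
      "\<And>i. \<forall>x\<in>f ` {..<N}. \<gamma> i x = (if x = f i then 1 else 0)"
    by metis
  have "\<gamma> i (f j) = (if i = j then 1 else 0)" if "i < N" "j < N" for i j
    using \<gamma>(2)[of i] that inj_onD[OF assms(2), of i j] by auto
  then show ?thesis using that \<gamma>(1) by blast
qed

lemma coad_mats: "coad n a c F x \<in> mats n"
  by (auto simp: coad_def mats_def)

lemma tendsto_functional_coad:
  assumes \<gamma>: "Vector_Spaces.linear cscale (*) \<gamma>"
    and H: "\<And>i j. ((\<lambda>e. H e i j) \<longlongrightarrow> h i j) Fl"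
  shows "((\<lambda>e. \<gamma> (coad n a c (H e) x)) \<longlongrightarrow> \<gamma> (coad n a c h x)) Fl"
proof -
  have "((\<lambda>e. coad n a c (H e) x i j) \<longlongrightarrow> coad n a c h x i j) Fl" for i j
  proof (cases "i < n \<and> j < n \<and> admissible a c j i")
    case True
    have "((\<lambda>e. mat_mul n (H e) x i j - mat_mul n x (H e) i j)
        \<longlongrightarrow> mat_mul n h x i j - mat_mul n x h i j) Fl"
      by (intro tendsto_diff tendsto_mat_mul H tendsto_const)
    then show ?thesis using True by (simp add: coad_def bracket_def)
  next
    case False
    then have "coad n a c G x i j = 0" for G unfolding coad_def by auto
    then show ?thesis by simp
  qed
  then show ?thesis
    unfolding functional_expand[OF \<gamma> coad_mats] by (intro tendsto_intros)
qed

text \<open>Suppose a basis \<open>b\<close> of the kernel of \<open>F'\<close> has fewer than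
  \<open>g\<close> elements. On a complement \<open>coad n a c F'\<close> is injective, so suitable
  functionals \<open>\<gamma>\<close> turn it into an identity matrix. The complement is too large
  to avoid a conjugate of the torus, so the same determinant vanishes along all curves from
  \<open>conjugate_curve\<close>, and then at \<open>F'\<close> as well.\<close>

theorem kernel_lower_bound:
  assumes F: "regular_form n a c F" and n: "0 < n"
    and Y: "gl_kernel n a c F' \<subseteq> mv.span Y" "finite Y"
  shows "seaweed_gcd n a c \<le> card Y"
proof (rule ccontr)
  let ?q = "gl_seaweed n a c" and ?K = "gl_kernel n a c F'"
  assume less: "\<not> seaweed_gcd n a c \<le> card Y"
  obtain b where b: "b \<subseteq> ?K" "mv.independent b" "?K \<subseteq> mv.span b"
    using mv.maximal_independent_subset by blast
  have "finite b \<and> card b \<le> card Y"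
    using mv.independent_span_bound[OF Y(2) b(2)] b(1) Y(1) by blast
  then have finb: "finite b" and cb: "card b < seaweed_gcd n a c" using less by auto
  have "b \<subseteq> ?q" using b(1) by (auto simp: gl_kernel_def)
  then obtain Z where Z: "b \<subseteq> Z" "Z \<subseteq> ?q" "mv.independent Z" "?q \<subseteq> mv.span Z"
    using mv.maximal_independent_subset_extend[OF _ b(2)] by blast
  have finZ: "finite Z" using finite_independent_mats[OF Z(3)] Z(2) gl_seaweed_mats by blast
  define N where "N = card (Z - b)"
  have cardZ: "card Z < N + seaweed_gcd n a c"
    using cb finZ finb Z(1) by (simp add: N_def card_Diff_subset card_mono)
  obtain w where w: "bij_betw w {..<N} (Z - b)"
    using ex_bij_betw_nat_finite[of "Z - b"] finZ by (auto simp: N_def lessThan_atLeast0)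
  have wi: "w ` {..<N} = Z - b" "inj_on w {..<N}" using w by (auto simp: bij_betw_def)
  have indw: "mv.independent (Z - b)" using mv.independent_mono[OF Z(3)] by blast
  interpret l: Vector_Spaces.linear cscale cscale "coad n a c F'" by (rule linear_coad)
  have "x = 0" if x: "x \<in> mv.span (Z - b)" "coad n a c F' x = 0" for x
  proof -
    have "Z - b \<subseteq> ?q" using Z(2) by blast
    then have "x \<in> ?q" using mv.span_minimal[OF _ subspace_gl_seaweed] x(1) by blast
    then have "x \<in> mv.span b" using x(2) b(3) gl_kernel_iff by blast
    then show ?thesis using independent_complement_span[OF Z(3,1) x(1)] by blast
  qed
  then have inj: "inj_on (coad n a c F') (mv.span (Z - b))"
    using l.inj_on_iff_eq_0[OF mv.subspace_span] by blast
  define f where "f j = coad n a c F' (w j)" for j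
  have f_image: "f ` {..<N} = coad n a c F' ` (Z - b)" by (simp add: f_def image_image flip: wi(1))
  have "mv.independent (f ` {..<N})"
    unfolding f_image by (rule l.independent_inj_on_image[OF indw inj])
  moreover have "inj_on f {..<N}"
  proof (rule inj_onI)
    fix i j assume ij: "i \<in> {..<N}" "j \<in> {..<N}" "f i = f j"
    then have "w i \<in> mv.span (Z - b)" "w j \<in> mv.span (Z - b)" using wi(1) mv.span_base by blast+
    then have "w i = w j" using inj_onD[OF inj] ij(3) by (simp add: f_def)
    then show "i = j" using inj_onD[OF wi(2)] ij by blast
  qed
  ultimately obtain \<gamma> :: "nat \<Rightarrow> (nat \<Rightarrow> nat \<Rightarrow> complex) \<Rightarrow> complex" where
    \<gamma>: "\<And>i. Vector_Spaces.linear cscale (*) (\<gamma> i)"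
      "\<And>i j. i < N \<Longrightarrow> j < N \<Longrightarrow> \<gamma> i (f j) = (if i = j then 1 else 0)"
    using dual_functionals by blast
  define c0 where "c0 = (\<lambda>i j. \<gamma> i (coad n a c F (w j)))"
  define B where "B = (\<lambda>h i j. \<gamma> i (coad n a c h (w j)))"
  have wq: "w j \<in> ?q" if "j < N" for j using that wi(1) Z(2) by blast
  have split: "c0 i j + z * B h i j = \<gamma> i (coad n a c (F + cscale z h) (w j))" for i j z h
  proof -
    interpret \<gamma>: Vector_Spaces.linear cscale "(*)" "\<gamma> i" by (rule \<gamma>(1))
    show ?thesis unfolding c0_def B_def coad_add_left coad_scale_left \<gamma>.add \<gamma>.scale ..
  qed
  \<comment> \<open>The direction \<open>F' - F\<close> leads from \<open>F\<close> to
    \<open>F'\<close> at parameter \<open>1\<close>, where the matrix is the identity.\<close>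
  have "det (mat N N (\<lambda>(i, j). c0 i j + B (F' - F) i j)) = 0"
  proof (rule det_zero_from_curves[where S = "range B"])
    fix b' assume "b' \<in> range B"
    then obtain h where h: "b' = B h" by (rule rangeE)
    obtain H h0 where H: "\<And>i j. i < n \<Longrightarrow> j < n \<Longrightarrow> admissible a c j i \<Longrightarrow> h0 i j = h i j"
      "\<And>i j. ((\<lambda>e. H e i j) \<longlongrightarrow> h0 i j) (at_right 0)"
      "eventually (\<lambda>e. \<exists>v g. v \<in> ?q \<and> g \<in> ?q \<and> mat_mul n g v = idm n \<and> mat_mul n v g = idm n \<and>
         (\<forall>t \<in> periodic_diag n (seaweed_gcd n a c).
            mat_mul n v (mat_mul n t g) \<in> gl_kernel n a c (F + cscale (complex_of_real e) (H e)))) (at_right 0)"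
      by (rule conjugate_curve[OF F, where h = h]) (rule that)
    have "((\<lambda>e. B (H e) i j) \<longlongrightarrow> b' i j) (at_right 0)" if "i < N" "j < N" for i j
    proof -
      have "coad n a c h0 (w j) = coad n a c h (w j)" using coad_cong[OF wq] H(1) that by blast
      moreover have "((\<lambda>e. \<gamma> i (coad n a c (H e) (w j))) \<longlongrightarrow> \<gamma> i (coad n a c h0 (w j))) (at_right 0)"
        by (rule tendsto_functional_coad) (rule \<gamma>(1) H(2))+
      ultimately show ?thesis by (simp add: B_def h)
    qed
    moreover have "eventually (\<lambda>e. det (mat N N (\<lambda>(i, j). c0 i j + complex_of_real e * B (H e) i j)) = 0) (at_right 0)"
      using H(3)
    proof eventually_elim
      case (elim e)
      then obtain v g where vg: "v \<in> ?q" "g \<in> ?q" "mat_mul n g v = idm n" "mat_mul n v g = idm n"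
         "\<forall>t \<in> periodic_diag n (seaweed_gcd n a c).
            mat_mul n v (mat_mul n t g) \<in> gl_kernel n a c (F + cscale (complex_of_real e) (H e))"
        by blast
      show ?case
        unfolding split
        by (rule coad_matrix_singular[OF seaweed_gcd_bounds(2)[OF n] vg finZ Z(4) _ wi(2) _ cardZ \<gamma>(1)])
          (use indw Z(2) in \<open>auto simp: wi(1)\<close>)
    qed
    ultimately show "\<exists>B'. (\<forall>e. B' e \<in> range B) \<and>
       (\<forall>i<N. \<forall>j<N. ((\<lambda>e. B' e i j) \<longlongrightarrow> b' i j) (at_right (0::real))) \<and>
       eventually (\<lambda>e. det (mat N N (\<lambda>(i, j). c0 i j + complex_of_real e * B' e i j)) = 0) (at_right 0)"
      by (intro exI[of _ "\<lambda>e. B (H e)"]) auto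
  qed simp
  moreover have "mat N N (\<lambda>(i, j). c0 i j + B (F' - F) i j) = 1\<^sub>m N"
  proof (rule eq_matI)
    fix i j assume "i < dim_row (1\<^sub>m N :: complex mat)" "j < dim_col (1\<^sub>m N :: complex mat)"
    then have ij: "i < N" "j < N" by simp_all
    have "F + cscale 1 (F' - F) = F'" by (simp add: fun_eq_iff)
    then have "c0 i j + B (F' - F) i j = \<gamma> i (f j)"
      using split[of i j 1 "F' - F"] by (simp only: f_def mult_1)
    then show "mat N N (\<lambda>(i, j). c0 i j + B (F' - F) i j) $$ (i, j) = 1\<^sub>m N $$ (i, j)"
      using ij \<gamma>(2)[OF ij] by simp
  qed simp_all
  ultimately show False by (simp only: det_one one_neq_zero)
qed

section \<open>The index of the seaweed in sl\<close>

text \<open>Basis vectors with index outside \<open>P\<close> lie in the subspace, and their images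
  show which entries must vanish. A predicate \<open>P\<close> covers initial and final coordinate
  subspaces alike.\<close>

lemma preserves_coordinates:
  assumes M: "M \<in> mats n"
  shows "preserves n M {v \<in> vecs n. \<forall>p. P p \<longrightarrow> v p = 0} \<longleftrightarrow> (\<forall>i j. P i \<and> \<not> P j \<longrightarrow> M i j = 0)"
proof
  assume L: "preserves n M {v \<in> vecs n. \<forall>p. P p \<longrightarrow> v p = 0}"
  show "\<forall>i j. P i \<and> \<not> P j \<longrightarrow> M i j = 0"
  proof (intro allI impI)
    fix i j assume ij: "P i \<and> \<not> P j"
    define v :: "nat \<Rightarrow> complex" where "v p = (if p = j then 1 else 0)" for p
    show "M i j = 0"
    proof (cases "j < n")
      case True
      then have "v \<in> {v \<in> vecs n. \<forall>p. P p \<longrightarrow> v p = 0}" using ij by (auto simp: vecs_def v_def)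
      then have "mat_vec n M v i = 0" using L ij unfolding preserves_def by blast
      moreover have "mat_vec n M v i = (\<Sum>l<n. if l = j then M i j else 0)"
        unfolding mat_vec_def v_def by (intro sum.cong) auto
      ultimately show ?thesis using True by simp
    qed (use M in \<open>simp add: mats_def\<close>)
  qed
next
  assume R: "\<forall>i j. P i \<and> \<not> P j \<longrightarrow> M i j = 0"
  have "mat_vec n M v \<in> {v \<in> vecs n. \<forall>p. P p \<longrightarrow> v p = 0}"
    if v: "v \<in> vecs n" "\<forall>p. P p \<longrightarrow> v p = 0" for v
  proof -
    have "mat_vec n M v p = 0" if "P p" for p
      unfolding mat_vec_def using R v that by (intro sum.neutral) auto
    moreover have "mat_vec n M v \<in> vecs n" using M by (auto simp: vecs_def mats_def mat_vec_def)
    ultimately show ?thesis by blast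
  qed
  then show "preserves n M {v \<in> vecs n. \<forall>p. P p \<longrightarrow> v p = 0}" unfolding preserves_def by blast
qed

lemma seaweed_eq:
  assumes "a + b = n" "c + d = n"
  shows "seaweed n [a, b] [c, d] = {x \<in> gl_seaweed n a c. trace n x = 0}"
proof -
  have V: "preserves n M (flagV n [a, b] i) \<longleftrightarrow>
      (\<forall>k l. sum_list (take i [a, b]) \<le> k \<and> \<not> sum_list (take i [a, b]) \<le> l \<longrightarrow> M k l = 0)"
    if "M \<in> mats n" for M i
    unfolding flagV_def by (rule preserves_coordinates[OF that])
  have W: "preserves n M (flagW n [c, d] j) \<longleftrightarrow>
      (\<forall>k l. k < sum_list (take j [c, d]) \<and> \<not> l < sum_list (take j [c, d]) \<longrightarrow> M k l = 0)"
    if "M \<in> mats n" for M j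
    unfolding flagW_def by (rule preserves_coordinates[OF that])
  \<comment> \<open>The proper subspaces, at \<open>i = 1\<close> and \<open>j = 1\<close>, yield
    the two implications in \<open>admissible\<close>.\<close>
  have sets: "{1..length [a, b]} = {1, 2}" "{0..length [c, d]} = {0, 1, 2}" by auto
  have "(\<forall>i\<in>{1..length [a, b]}. preserves n M (flagV n [a, b] i)) \<and>
      (\<forall>j\<in>{0..length [c, d]}. preserves n M (flagW n [c, d] j)) \<longleftrightarrow>
      (\<forall>i j. M i j \<noteq> 0 \<longrightarrow> admissible a c i j)" if M: "M \<in> mats n" for M
  proof -
    have out: "\<And>i j. n \<le> i \<or> n \<le> j \<Longrightarrow> M i j = 0" using M unfolding mats_def by blast
    show ?thesis
      unfolding sets using assms out
      by (simp add: V[OF M] W[OF M] admissible_def numeral_2_eq_2 not_le not_less) (meson not_le)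
  qed
  then show ?thesis unfolding seaweed_def gl_seaweed_def by blast
qed

section \<open>Traces and the traceless seaweed\<close>

lemma pairing_add_right: "pairing n C (A + B) = pairing n C A + pairing n C B"
  by (simp add: pairing_def distrib_left sum.distrib)

lemma pairing_scale_right: "pairing n A (cscale z B) = z * pairing n A B"
  unfolding pairing_def sum_distrib_left by (intro sum.cong refl mult.left_commute)

lemma trace_mat_mul: "trace n (mat_mul n A B) = pairing n A B"
  by (simp add: trace_def mat_mul_def pairing_def)

lemma trace_bracket: "trace n (bracket n A B) = 0"
  using trace_mat_mul[of n A B] trace_mat_mul[of n B A] pairing_commute[of n A B]
  by (simp add: trace_def bracket_def sum_subtractf)

lemma trace_idm: "trace n (idm n) = of_nat n"
  by (simp add: trace_def idm_def)

lemma trace_add: "trace n (A + B) = trace n A + trace n B"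
  by (simp add: trace_def sum.distrib)

lemma trace_scale: "trace n (cscale z A) = z * trace n A"
  by (simp add: trace_def sum_distrib_left)

lemma trace_unit_mat: "trace n (unit_mat i j) = (if i = j \<and> i < n then 1 else 0)"
proof -
  have "trace n (unit_mat i j) = (\<Sum>k<n. if k = i then (if i = j then 1 else 0) else 0)"
    unfolding trace_def unit_mat_def by (intro sum.cong) auto
  then show ?thesis by simp
qed

definition sl_seaweed :: "nat \<Rightarrow> nat \<Rightarrow> nat \<Rightarrow> (nat \<Rightarrow> nat \<Rightarrow> complex) set" where
  "sl_seaweed n a c = {x \<in> gl_seaweed n a c. trace n x = 0}"

lemma subspace_trace_zero: "mv.subspace {x. trace n x = 0}"
  by (rule mv.subspaceI) (auto simp: trace_add trace_scale, simp add: trace_def)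

lemma subspace_sl_seaweed: "mv.subspace (sl_seaweed n a c)"
proof -
  have "sl_seaweed n a c = gl_seaweed n a c \<inter> {x. trace n x = 0}" by (auto simp: sl_seaweed_def)
  then show ?thesis using mv.subspace_inter[OF subspace_gl_seaweed subspace_trace_zero] by simp
qed

lemma sl_seaweed_bracket:
  assumes "x \<in> sl_seaweed n a c" "y \<in> sl_seaweed n a c"
  shows "bracket n x y \<in> sl_seaweed n a c"
proof -
  have "x \<in> gl_seaweed n a c" "y \<in> gl_seaweed n a c" using assms by (auto simp: sl_seaweed_def)
  then have "bracket n x y \<in> gl_seaweed n a c"
    unfolding bracket_eq by (intro mv.subspace_diff[OF subspace_gl_seaweed] gl_seaweed_mult)
  then show ?thesis by (simp add: sl_seaweed_def trace_bracket)
qed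

text \<open>A spanning family of the traceless seaweed: \<open>E_ij\<close> off the diagonal,
  \<open>E_ii - E_00\<close> on it. The default \<open>0\<close> keeps all values inside the
  algebra, the only place where a \<open>linear_on\<close> functional is controlled.\<close>

definition sl_unit :: "nat \<Rightarrow> nat \<Rightarrow> nat \<Rightarrow> nat \<Rightarrow> nat \<Rightarrow> nat \<Rightarrow> nat \<Rightarrow> complex" where
  "sl_unit n a c i j = (if i < n \<and> j < n \<and> admissible a c i j
     then (if i = j then unit_mat i i - unit_mat 0 0 else unit_mat i j) else 0)"

lemma sl_unit_mem: "sl_unit n a c i j \<in> sl_seaweed n a c"
proof -
  have gl: "unit_mat i j \<in> gl_seaweed n a c" if "i < n" "j < n" "admissible a c i j" for i j
    using that by (auto simp: gl_seaweed_def unit_mat_def mats_def)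
  have "unit_mat i i - unit_mat 0 0 \<in> sl_seaweed n a c" if "i < n"
  proof -
    have "trace n (unit_mat i i - unit_mat 0 0) = trace n (unit_mat i i) - trace n (unit_mat 0 0)"
      by (simp add: trace_def sum_subtractf)
    then show ?thesis
      using that mv.subspace_diff[OF subspace_gl_seaweed gl[of i i] gl[of 0 0]]
      by (simp add: sl_seaweed_def trace_unit_mat)
  qed
  moreover have "0 \<in> sl_seaweed n a c" by (rule mv.subspace_0[OF subspace_sl_seaweed])
  ultimately show ?thesis using gl by (auto simp: sl_unit_def sl_seaweed_def trace_unit_mat)
qed

text \<open>Replacing \<open>E_ii\<close> by \<open>E_ii - E_00\<close> changes the standard
  expansion by \<open>trace n x\<close> times \<open>E_00\<close>, which is zero.\<close>

lemma sl_expand: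
  assumes x: "x \<in> sl_seaweed n a c"
  shows "x = (\<Sum>i<n. \<Sum>j<n. cscale (x i j) (sl_unit n a c i j))"
proof -
  have xm: "x \<in> mats n" and adm: "\<And>i j. x i j \<noteq> 0 \<Longrightarrow> admissible a c i j" and tr: "trace n x = 0"
    using x by (auto simp: sl_seaweed_def gl_seaweed_def)
  have inner: "(\<Sum>j<n. cscale (x i j) (sl_unit n a c i j))
      = (\<Sum>j<n. cscale (x i j) (unit_mat i j)) - cscale (x i i) (unit_mat 0 0)" if "i < n" for i
  proof -
    have "(\<Sum>j<n. cscale (x i j) (sl_unit n a c i j))
        = (\<Sum>j<n. cscale (x i j) (unit_mat i j) - (if j = i then cscale (x i i) (unit_mat 0 0) else 0))"
    proof (intro sum.cong refl)
      fix j assume "j \<in> {..<n}"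
      then show "cscale (x i j) (sl_unit n a c i j)
          = cscale (x i j) (unit_mat i j) - (if j = i then cscale (x i i) (unit_mat 0 0) else 0)"
        using adm[of i j] that
        by (cases "x i j = 0") (auto simp: sl_unit_def fun_eq_iff algebra_simps)
    qed
    then show ?thesis using that by (simp add: sum_subtractf)
  qed
  have "(\<Sum>i<n. \<Sum>j<n. cscale (x i j) (sl_unit n a c i j))
      = (\<Sum>i<n. \<Sum>j<n. cscale (x i j) (unit_mat i j)) - (\<Sum>i<n. cscale (x i i) (unit_mat 0 0))"
    using inner by (simp add: sum_subtractf)
  also have "(\<Sum>i<n. cscale (x i i) (unit_mat 0 0)) = cscale (trace n x) (unit_mat 0 0)"
    by (simp add: fun_eq_iff sum_fun_apply trace_def sum_distrib_right)
  also have "\<dots> = 0" using tr by (simp add: fun_eq_iff)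
  finally show ?thesis using mats_expand[OF xm] by simp
qed

lemma linear_on_sum:
  assumes f: "linear_on V f" and V: "mv.subspace V" and y: "\<And>s. s \<in> S \<Longrightarrow> y s \<in> V"
  shows "f (\<Sum>s\<in>S. y s) = (\<Sum>s\<in>S. f (y s))"
proof -
  have zero: "f 0 = 0"
  proof -
    have "f (cscale 0 0) = 0 * f 0" using f mv.subspace_0[OF V] unfolding linear_on_def by blast
    then show ?thesis by (simp add: zero_fun_def)
  qed
  show ?thesis
    using y
  proof (induction S rule: infinite_finite_induct)
    case (insert s S)
    then have "f (y s + sum y S) = f (y s) + f (sum y S)"
      using f mv.subspace_sum[OF V, of S y] unfolding linear_on_def by blast
    moreover have "f (sum y S) = (\<Sum>s\<in>S. f (y s))" using insert by blast
    ultimately show ?case by (simp only: sum.insert[OF insert.hyps])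
  qed (simp_all add: zero)
qed

lemma linear_on_pairing:
  assumes f: "linear_on (sl_seaweed n a c) f"
  obtains F where "F \<in> mats n" "\<And>x. x \<in> sl_seaweed n a c \<Longrightarrow> f x = pairing n F x"
proof
  define F where "F = (\<lambda>i j. if i < n \<and> j < n then f (sl_unit n a c j i) else 0)"
  show "F \<in> mats n" by (simp add: F_def mats_def)
  fix x assume x: "x \<in> sl_seaweed n a c"
  have mem: "cscale (x i j) (sl_unit n a c i j) \<in> sl_seaweed n a c" for i j
    by (rule mv.subspace_scale[OF subspace_sl_seaweed sl_unit_mem])
  have "f x = f (\<Sum>i<n. \<Sum>j<n. cscale (x i j) (sl_unit n a c i j))"
    using sl_expand[OF x] by simp
  also have "\<dots> = (\<Sum>i<n. f (\<Sum>j<n. cscale (x i j) (sl_unit n a c i j)))"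
    by (intro linear_on_sum[OF f subspace_sl_seaweed] mv.subspace_sum[OF subspace_sl_seaweed] mem)
  also have "\<dots> = (\<Sum>i<n. \<Sum>j<n. f (cscale (x i j) (sl_unit n a c i j)))"
    by (intro sum.cong refl linear_on_sum[OF f subspace_sl_seaweed] mem)
  also have "\<dots> = (\<Sum>i<n. \<Sum>j<n. x i j * f (sl_unit n a c i j))"
    using f sl_unit_mem unfolding linear_on_def by (intro sum.cong refl) blast
  also have "\<dots> = pairing n x F"
    unfolding pairing_def by (intro sum.cong) (auto simp: F_def)
  finally show "f x = pairing n F x" by (simp only: pairing_commute)
qed

text \<open>Traceless test matrices see the diagonal of \<open>[F, x]\<close> only up to a common
  scalar. A commutator has trace zero and \<open>n > 0\<close>, so the scalar vanishes and the
  condition is the same as in \<open>gl\<close>.\<close>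

lemma kerB_pairing:
  assumes n: "0 < n" and f: "\<And>x. x \<in> sl_seaweed n a c \<Longrightarrow> f x = pairing n F x"
  shows "kerB n (sl_seaweed n a c) f = {x \<in> gl_kernel n a c F. trace n x = 0}"
proof -
  have "(\<forall>y\<in>sl_seaweed n a c. f (bracket n x y) = 0) \<longleftrightarrow> x \<in> gl_kernel n a c F"
    if x: "x \<in> sl_seaweed n a c" for x
  proof -
    have fb: "f (bracket n x y) = pairing n (bracket n F x) y" if "y \<in> sl_seaweed n a c" for y
      using f[OF sl_seaweed_bracket[OF x that]] by (simp add: pairing_bracket)
    show ?thesis
    proof
      assume L: "\<forall>y\<in>sl_seaweed n a c. f (bracket n x y) = 0"
      have unit: "pairing n (bracket n F x) (sl_unit n a c j i) = 0" for i j
        using L fb sl_unit_mem by metis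
      have offdiag: "bracket n F x i j = 0" if "i < n" "j < n" "admissible a c j i" "i \<noteq> j" for i j
        using unit[of j i] that pairing_unit_mat[of i n j "bracket n F x"] by (simp add: sl_unit_def)
      have diag: "bracket n F x i i = bracket n F x 0 0" if "i < n" for i
        using unit[of i i] that n pairing_unit_mat[of i n i "bracket n F x"]
          pairing_unit_mat[of 0 n 0 "bracket n F x"]
        by (simp add: sl_unit_def pairing_diff_right)
      have "0 = (\<Sum>i<n. bracket n F x i i)" using trace_bracket[of n F x] by (simp add: trace_def)
      also have "\<dots> = (\<Sum>i<n. bracket n F x 0 0)" by (rule sum.cong[OF refl diag]) simp
      finally have "bracket n F x 0 0 = 0" using n by simp
      then have "bracket n F x i i = 0" if "i < n" for i using diag[OF that] by (rule trans[rotated])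
      then have "bracket n F x i j = 0" if "i < n" "j < n" "admissible a c j i" for i j
        using that offdiag by (cases "i = j") auto
      then show "x \<in> gl_kernel n a c F" using x by (simp add: gl_kernel_def sl_seaweed_def)
    next
      assume R: "x \<in> gl_kernel n a c F"
      have "pairing n (bracket n F x) y = 0" if y: "y \<in> sl_seaweed n a c" for y
        unfolding pairing_def
      proof (intro sum.neutral ballI)
        fix i j assume "i \<in> {..<n}" "j \<in> {..<n}"
        then show "bracket n F x i j * y j i = 0"
          using R y unfolding gl_kernel_def sl_seaweed_def gl_seaweed_def by (cases "y j i = 0") auto
      qed
      then show "\<forall>y\<in>sl_seaweed n a c. f (bracket n x y) = 0" using fb by simp
    qed
  qed
  then show ?thesis unfolding kerB_def by (auto simp: sl_seaweed_def gl_kernel_def)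
qed

lemma idm_gl_kernel: "F \<in> mats n \<Longrightarrow> idm n \<in> gl_kernel n a c F"
  by (simp add: gl_kernel_def idm_gl_seaweed bracket_eq mat_mul_idm_left mat_mul_idm_right)

lemma periodic_diag_span:
  assumes g: "0 < g" "g \<le> n"
  shows "periodic_diag n g \<subseteq> mv.span (class_idm n g ` {..<g})"
proof
  fix x assume "x \<in> periodic_diag n g"
  then have off: "\<And>i j. i \<noteq> j \<Longrightarrow> x i j = 0" and out: "\<And>i. n \<le> i \<Longrightarrow> x i i = 0"
    and per: "\<And>i j. i < n \<Longrightarrow> j < n \<Longrightarrow> i mod g = j mod g \<Longrightarrow> x i i = x j j"
    unfolding periodic_diag_def mats_def by blast+
  have "x = (\<Sum>k<g. cscale (x k k) (class_idm n g k))"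
  proof (intro ext)
    fix i j
    have "(\<Sum>k<g. cscale (x k k) (class_idm n g k)) i j
        = (\<Sum>k<g. if k = i mod g then (if i = j \<and> i < n then x k k else 0) else 0)"
      unfolding sum_fun_apply by (intro sum.cong) (auto simp: class_idm_def)
    also have "\<dots> = (if i = j \<and> i < n then x (i mod g) (i mod g) else 0)"
      using g by simp
    also have "\<dots> = x i j"
    proof (cases "i = j")
      case True
      have "i mod g < n" using g mod_less_divisor[of g i] by linarith
      then show ?thesis using True out[of i] per[of i "i mod g"] by (cases "i < n") auto
    next
      case False
      then show ?thesis using off by simp
    qed
    finally show "x i j = (\<Sum>k<g. cscale (x k k) (class_idm n g k)) i j" ..
  qed
  moreover have "(\<Sum>k<g. cscale (x k k) (class_idm n g k)) \<in> mv.span (class_idm n g ` {..<g})"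
    by (intro mv.span_sum mv.span_scale mv.span_base) simp
  ultimately show "x \<in> mv.span (class_idm n g ` {..<g})" by simp
qed

text \<open>The identity lies in every \<open>gl\<close> kernel but is not traceless, so each such
  kernel is its traceless part plus one line. Both bounds adjoin \<open>idm n\<close> to a basis of
  the traceless part.\<close>

theorem lie_index_sl_seaweed:
  assumes n: "0 < n" and ac: "a \<le> n" "c \<le> n"
  shows "lie_index n (sl_seaweed n a c) = seaweed_gcd n a c - 1"
proof -
  let ?q = "sl_seaweed n a c" and ?g = "seaweed_gcd n a c"
  obtain F0 where F0: "regular_form n a c F0" using regular_form_exists[OF ac] by blast
  have basis: "\<exists>b \<subseteq> {x \<in> gl_kernel n a c F. trace n x = 0}. mv.independent b \<and> finite b \<and>
      {x \<in> gl_kernel n a c F. trace n x = 0} \<subseteq> mv.span b \<and>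
      card b = cdim {x \<in> gl_kernel n a c F. trace n x = 0}" for F
  proof -
    obtain b where b: "b \<subseteq> {x \<in> gl_kernel n a c F. trace n x = 0}" "mv.independent b"
      "{x \<in> gl_kernel n a c F. trace n x = 0} \<subseteq> mv.span b"
      "card b = mv.dim {x \<in> gl_kernel n a c F. trace n x = 0}"
      using mv.basis_exists by blast
    moreover have "b \<subseteq> mats n" using b(1) by (auto simp: gl_kernel_def gl_seaweed_def)
    then have "finite b" using finite_independent_mats[OF b(2)] by blast
    ultimately show ?thesis unfolding cdim_def by blast
  qed
  have lower: "?g - 1 \<le> cdim (kerB n ?q f)" if f: "linear_on ?q f" for f
  proof -
    obtain F where F: "F \<in> mats n" "\<And>x. x \<in> ?q \<Longrightarrow> f x = pairing n F x"
      using linear_on_pairing[OF f] by blast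
    obtain b where b: "mv.independent b" "finite b"
      "{x \<in> gl_kernel n a c F. trace n x = 0} \<subseteq> mv.span b"
      "card b = cdim {x \<in> gl_kernel n a c F. trace n x = 0}"
      using basis by blast
    have "x \<in> mv.span (insert (idm n) b)" if x: "x \<in> gl_kernel n a c F" for x
    proof -
      let ?z = "trace n x / of_nat n"
      let ?y = "x + cscale (- ?z) (idm n)"
      have "?y \<in> gl_kernel n a c F"
        by (intro mv.subspace_add[OF subspace_gl_kernel] x mv.subspace_scale[OF subspace_gl_kernel]
            idm_gl_kernel F(1))
      moreover have "trace n ?y = 0" unfolding trace_add trace_scale trace_idm using n by simp
      ultimately have "?y \<in> mv.span b" using b(3) by blast
      then have "?y \<in> mv.span (insert (idm n) b)" using mv.span_mono[of b "insert (idm n) b"] by blast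
      moreover have "cscale ?z (idm n) \<in> mv.span (insert (idm n) b)"
        by (intro mv.span_scale mv.span_base) simp
      ultimately have "?y + cscale ?z (idm n) \<in> mv.span (insert (idm n) b)" by (rule mv.span_add)
      moreover have "?y + cscale ?z (idm n) = x"
        by (intro ext) (simp only: plus_fun_apply, simp)
      ultimately show ?thesis by (simp only:)
    qed
    then have "?g \<le> card (insert (idm n) b)"
      using kernel_lower_bound[OF F0 n, of F "insert (idm n) b"] b(2) by blast
    also have "\<dots> \<le> Suc (card b)" by (rule card_insert_le_m1) auto
    finally show ?thesis using b(4) kerB_pairing[OF n F(2)] by simp
  qed
  let ?f = "pairing n F0"
  have lin: "linear_on ?q ?f"
    unfolding linear_on_def by (intro conjI ballI allI pairing_add_right pairing_scale_right)
  have upper: "cdim (kerB n ?q ?f) \<le> ?g - 1"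
  proof -
    obtain b where b: "b \<subseteq> {x \<in> gl_kernel n a c F0. trace n x = 0}" "mv.independent b" "finite b"
      "card b = cdim {x \<in> gl_kernel n a c F0. trace n x = 0}"
      using basis by blast
    have "mv.span b \<subseteq> {x. trace n x = 0}"
      by (rule mv.span_minimal[OF _ subspace_trace_zero]) (use b(1) in blast)
    then have nb: "idm n \<notin> mv.span b" using n trace_idm[of n] by auto
    have ind: "mv.independent (insert (idm n) b)" using nb b(2) by (rule mv.independent_insertI)
    have "idm n \<in> periodic_diag n ?g" by (auto simp: periodic_diag_def mats_def idm_def)
    then have "insert (idm n) b \<subseteq> periodic_diag n ?g"
      using b(1) F0 by (auto simp: regular_form_def)
    then have "insert (idm n) b \<subseteq> mv.span (class_idm n ?g ` {..<?g})"
      using periodic_diag_span[OF seaweed_gcd_bounds[OF n]] by blast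
    then have "card (insert (idm n) b) \<le> card (class_idm n ?g ` {..<?g})"
      using mv.independent_span_bound[OF _ ind] by blast
    also have "\<dots> \<le> ?g" using card_image_le[of "{..<?g}" "class_idm n ?g"] by simp
    finally have "Suc (card b) \<le> ?g" using nb b(3) mv.span_base by (metis card_insert_disjoint)
    then show ?thesis using b(4) kerB_pairing[OF n, of a c ?f F0] by simp
  qed
  show ?thesis
    unfolding lie_index_def
  proof (rule Least_equality)
    show "\<exists>f. linear_on ?q f \<and> ?g - 1 = cdim (kerB n ?q f)"
      using lin lower[OF lin] upper by (intro exI[of _ ?f]) simp
    show "?g - 1 \<le> d" if "\<exists>f. linear_on ?q f \<and> d = cdim (kerB n ?q f)" for d
      using that lower by blast
  qed
qed

section \<open>Counting\<close>

text \<open>A quadruple is determined by \<open>(a, c)\<close>. Since \<open>seaweed_gcd\<close> is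
  positive, the truncated difference \<open>seaweed_gcd n a c - 1\<close> equals \<open>k\<close>
  only for \<open>Suc k\<close>.\<close>

lemma C22_eq:
  "C22 n k = card {(a, c). 0 < a \<and> a < n \<and> 0 < c \<and> c < n \<and> seaweed_gcd n a c = Suc k}"
proof -
  let ?Q = "{(a, b, c, d). 0 < a \<and> 0 < b \<and> 0 < c \<and> 0 < d \<and> a + b = n \<and> c + d = n \<and>
     lie_index n (seaweed n [a, b] [c, d]) = k}"
  let ?P = "{(a, c). 0 < a \<and> a < n \<and> 0 < c \<and> c < n \<and> seaweed_gcd n a c = Suc k}"
  have idx: "lie_index n (seaweed n [a, b] [c, d]) = k \<longleftrightarrow> seaweed_gcd n a c = Suc k"
    if "0 < a" "a + b = n" "c + d = n" for a b c d
  proof -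
    have "0 < n" "a \<le> n" "c \<le> n" using that by auto
    then show ?thesis
      using lie_index_sl_seaweed[of n a c] seaweed_gcd_bounds(1)[of n a c] seaweed_eq[OF that(2,3)]
      by (auto simp: sl_seaweed_def)
  qed
  have "?Q = {(a, b, c, d). 0 < a \<and> 0 < b \<and> 0 < c \<and> 0 < d \<and> a + b = n \<and> c + d = n \<and>
     seaweed_gcd n a c = Suc k}" (is "_ = ?Q'")
    using idx by blast
  moreover have "bij_betw (\<lambda>(a, b, c, d). (a, c)) ?Q' ?P"
    by (rule bij_betw_byWitness[where f' = "\<lambda>(a, c). (a, n - a, c, n - c)"]) auto
  ultimately have "bij_betw (\<lambda>(a, b, c, d). (a, c)) ?Q ?P" by simp
  then show ?thesis unfolding C22_def by (rule bij_betw_same_card)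
qed

lemma seaweed_gcd_mod:
  assumes "c \<le> n"
  shows "seaweed_gcd n a c = gcd n ((a + n - c) mod n)"
proof -
  have "int ((a + n - c) mod n) = (int a - int c) mod int n"
  proof -
    have "int (a + n - c) = (int a - int c) + int n" using assms by linarith
    then show ?thesis by (simp only: zmod_int mod_add_self2)
  qed
  then have "int (gcd n ((a + n - c) mod n)) = gcd (int n) ((int a - int c) mod int n)"
    by (metis gcd_int_int_eq)
  also have "\<dots> = gcd (int n) (int a - int c)" by (metis gcd_red_int gcd.commute)
  finally show ?thesis unfolding seaweed_gcd_def by (metis nat_int)
qed

text \<open>For a fixed nonzero residue \<open>r\<close>, the value of \<open>a\<close> determines
  \<open>c\<close>, and \<open>c\<close> is nonzero exactly when \<open>a \<noteq> r\<close>. This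
  leaves \<open>n - 2\<close> of the \<open>n - 1\<close> values of \<open>a\<close>.\<close>

lemma card_pairs_by_difference:
  assumes R: "\<And>r. r \<in> R \<Longrightarrow> 0 < r \<and> r < n"
  shows "card {(a, c). 0 < a \<and> a < n \<and> 0 < c \<and> c < n \<and> (a + n - c) mod n \<in> R} = card R * (n - 2)"
proof -
  let ?P = "{(a, c). 0 < a \<and> a < n \<and> 0 < c \<and> c < n \<and> (a + n - c) mod n \<in> R}"
  let ?S = "SIGMA r:R. {1..<n} - {r}"
  have md: "(a + n - c) mod n = (if c \<le> a then a - c else a + n - c)" if "a < n" "c < n" for a c :: nat
    using that by (auto simp: mod_if)
  have "bij_betw (\<lambda>(a, c). ((a + n - c) mod n, a)) ?P ?S"
  proof (rule bij_betw_byWitness[where f' = "\<lambda>(r, a). (a, (a + n - r) mod n)"])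
    show "\<forall>p\<in>?P. (case case p of (a, c) \<Rightarrow> ((a + n - c) mod n, a) of (r, a) \<Rightarrow> (a, (a + n - r) mod n)) = p"
      by (auto simp: md)
    have S: "\<exists>r a. p = (r, a) \<and> r \<in> R \<and> 0 < r \<and> r < n \<and> 0 < a \<and> a < n \<and> a \<noteq> r" if "p \<in> ?S" for p
      using that R by auto
    have inv: "(a + n - r) mod n < n" "0 < (a + n - r) mod n" "(a + n - (a + n - r) mod n) mod n = r"
      if "0 < r" "r < n" "0 < a" "a < n" "a \<noteq> r" for r a
      using that by (cases "r \<le> a"; simp add: md)+
    show "\<forall>p\<in>?S. (case case p of (r, a) \<Rightarrow> (a, (a + n - r) mod n) of (a, c) \<Rightarrow> ((a + n - c) mod n, a)) = p"
    proof
      fix p assume "p \<in> ?S"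
      then obtain r a where "p = (r, a)" "0 < r" "r < n" "0 < a" "a < n" "a \<noteq> r" using S by blast
      then show "(case case p of (r, a) \<Rightarrow> (a, (a + n - r) mod n) of (a, c) \<Rightarrow> ((a + n - c) mod n, a)) = p"
        using inv(3)[of r a] by simp
    qed
    show "(\<lambda>(a, c). ((a + n - c) mod n, a)) ` ?P \<subseteq> ?S"
      by (auto simp: md split: if_splits)
    show "(\<lambda>(r, a). (a, (a + n - r) mod n)) ` ?S \<subseteq> ?P"
    proof
      fix q assume "q \<in> (\<lambda>(r, a). (a, (a + n - r) mod n)) ` ?S"
      then obtain p where "p \<in> ?S" "q = (case p of (r, a) \<Rightarrow> (a, (a + n - r) mod n))" by blast
      then obtain r a where "q = (a, (a + n - r) mod n)" "r \<in> R" "0 < r" "r < n" "0 < a" "a < n" "a \<noteq> r"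
        using S[of p] by auto
      then show "q \<in> ?P" using inv[of r a] by simp
    qed
  qed
  then have "card ?P = card ?S" by (rule bij_betw_same_card)
  also have "\<dots> = (\<Sum>r\<in>R. n - 2)"
  proof -
    have fin: "finite R" using R by (intro finite_subset[of R "{..<n}"]) auto
    have "card ({1..<n} - {r}) = n - 2" if "r \<in> R" for r
      using R[OF that] by (subst card_Diff_singleton) auto
    then show ?thesis using fin by simp
  qed
  finally show ?thesis by simp
qed

theorem mainTheorem9:
  fixes t k :: nat
  assumes "1 \<le> t"
  shows "(1 < t \<longrightarrow> C22 (t + t * k) k = (t + t * k - 2) * totient t) \<and>
         (t = 1 \<and> 1 \<le> k \<longrightarrow> C22 (1 + k) k = k)"
proof (intro conjI impI)
  assume t: "1 < t"
  define n where "n = t + t * k"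
  have n: "n = t * Suc k" by (simp add: n_def)
  have "1 * Suc k < t * Suc k" using t by (rule mult_less_mono1) simp
  then have n_gt: "Suc k < n" by (simp only: n mult_1)
  \<comment> \<open>The interval is the one in \<open>card_gcd_eq_totient\<close>. Its endpoint
    \<open>n\<close>, like the residue \<open>0\<close>, has gcd \<open>n\<close> with
    \<open>n\<close>, and \<open>n > Suc k\<close> because \<open>t > 1\<close>; so both are ruled
    out.\<close>
  define R where "R = {r \<in> {0<..n}. gcd r n = Suc k}"
  have R: "0 < r \<and> r < n" if "r \<in> R" for r
    using that n_gt by (cases "r = n") (auto simp: R_def)
  have "seaweed_gcd n a c = Suc k \<longleftrightarrow> (a + n - c) mod n \<in> R" if "c < n" for a c
  proof -
    have "(a + n - c) mod n < n" using n_gt by simp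
    moreover have "gcd 0 n \<noteq> Suc k" using n_gt by simp
    ultimately show ?thesis
      using that unfolding seaweed_gcd_mod[OF less_imp_le[OF that]] R_def gcd.commute[of n]
      by (cases "(a + n - c) mod n = 0") auto
  qed
  then have "C22 n k = card {(a, c). 0 < a \<and> a < n \<and> 0 < c \<and> c < n \<and> (a + n - c) mod n \<in> R}"
    unfolding C22_eq by (intro arg_cong[of _ _ card]) auto
  also have "\<dots> = card R * (n - 2)" using R by (rule card_pairs_by_difference)
  also have "card R = totient (n div Suc k)"
    unfolding R_def by (rule card_gcd_eq_totient) (use n_gt in simp, simp only: n dvd_triv_right)
  also have "n div Suc k = t" unfolding n by (rule nonzero_mult_div_cancel_right) simp
  finally show "C22 (t + t * k) k = (t + t * k - 2) * totient t"
    unfolding n_def by (simp only: mult.commute)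
next
  assume "t = 1 \<and> 1 \<le> k"
  \<comment> \<open>Now \<open>n = Suc k\<close>, so the gcd must be \<open>n\<close> itself. Only
    the residue \<open>0\<close> qualifies, and it allows one \<open>c\<close> for each of the
    \<open>k\<close> values of \<open>a\<close>.\<close>
  have "seaweed_gcd (1 + k) a c = Suc k \<longleftrightarrow> a = c" if "a < 1 + k" "c < 1 + k" for a c
  proof -
    have "seaweed_gcd (1 + k) a c = Suc k \<longleftrightarrow> int (Suc k) dvd int a - int c"
    proof -
      have "seaweed_gcd (1 + k) a c = Suc k \<longleftrightarrow> gcd (int (Suc k)) (int a - int c) = int (Suc k)"
        unfolding seaweed_gcd_def by (simp add: nat_eq_iff del: of_nat_Suc)
      also have "\<dots> \<longleftrightarrow> int (Suc k) dvd int a - int c"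
        by (metis abs_of_nat gcd_dvd2 gcd_proj1_if_dvd_int)
      finally show ?thesis .
    qed
    also have "\<dots> \<longleftrightarrow> a = c"
    proof
      assume "int (Suc k) dvd int a - int c"
      then have "int a - int c = 0" using that dvd_imp_le_int[of "int a - int c" "int (Suc k)"] by linarith
      then show "a = c" by simp
    qed simp
    finally show ?thesis .
  qed
  then have "C22 (1 + k) k = card ((\<lambda>a. (a, a)) ` {1..k})"
    unfolding C22_eq by (intro arg_cong[of _ _ card]) auto
  also have "\<dots> = k" by (subst card_image) (auto simp: inj_on_def)
  finally show "C22 (1 + k) k = k" .
qed

end
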